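(* For each ordering $\xi$ of the Pascal graph and each $k\ge1$, the subshift $(\Sigma_k,\sigma)$ is topologically weakly mixing.
   Context: The Pascal graph has vertex set $\mathscr V=\{(x,y):x,y\in\mathbb Z_{\ge0}\}$ and, for each $(x,y)\in\mathscr V$, one directed edge from $(x,y)$ to $(x+1,y)$ and one to $(x,y+1)$. The level of $(x,y)$ is $x+y$; the root is $(0,0)$. An ordering is a function $\xi:\mathscr V\to\{0,1\}$: for $x,y\ge1$ the edge from $(x-1,y)$ to $(x,y)$ is less than the edge from $(x,y-1)$ to $(x,y)$ if and only if $\xi(x,y)=1$ (the values of $\xi$ at vertices with $x=0$ or $y=0$ play no role; the unique edge entering such a non-root vertex is both minimal and maximal). $X$ is the set of infinite directed paths (edge sequences $\gamma=\gamma_1\gamma_2\dots$) starting at the root. Paths $\gamma\ne\eta$ are comparable if they eventually coincide; if $n$ is the largest index with $\gamma_n\neq\eta_n$, then $\gamma<\eta$ iff $\gamma_n<\eta_n$. For a path $\gamma$ not consisting entirely of maximal edges, $T_\xi\gamma$ is the smallest path larger than $\gamma$; $T_\xi^{-1}$ is defined on paths not consisting entirely of minimal edges. For $k\ge1$, $\mathscr P_k$ is the partition of $X$ into the $2^k$ cylinder sets determined by the first $k$ edges, used as a finite alphabet. The $k$-coding $\omega_k(\gamma)$ of $\gamma\in X$ is the (possibly one-sided or finite) sequence with $\omega_k(\gamma)_n=C\in\mathscr P_k$ iff $T_\xi^n\gamma\in C$, for all $n\in\mathbb Z$ for which $T_\xi^n\gamma$ is defined. $\Sigma_k\subset\mathscr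 P_k^{\mathbb Z}$ (depending on $\xi$) is the set of all two-sided sequences each of whose finite subblocks can be found in $\omega_k(\gamma)$ for some $\gamma\in X$, and $\sigma$ is the shift, $(\sigma\omega)_n=\omega_{n+1}$. Topologically weakly mixing means that the product system $(\Sigma_k\times\Sigma_k,\sigma\times\sigma)$ is topologically transitive (topologically ergodic). *)

theory Defs
  imports "HOL-Analysis.Analysis"
begin

type_synonym vertex = "nat \<times> nat"

text \<open>The Pascal graph has no multiple edges, so an edge is the pair of its source and its target.\<close>

type_synonym edge = "vertex \<times> vertex"

definition pascal_edges :: "edge set" where
  "pascal_edges = {((x, y), (x + 1, y)) | x y. True} \<union> {((x, y), (x, y + 1)) | x y. True}"

text \<open>Path indices start at 0: the edge \<open>\<gamma> i\<close> runs from level \<open>i\<close> to level \<open>i + 1\<close>.\<close>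

type_synonym path = "nat \<Rightarrow> edge"

definition paths :: "path set" where
  "paths = {\<gamma>. fst (\<gamma> 0) = (0, 0) \<and> (\<forall>i. \<gamma> i \<in> pascal_edges \<and> fst (\<gamma> (Suc i)) = snd (\<gamma> i))}"

text \<open>An ordering is a function \<open>\<xi>\<close> from vertices to \<open>bool\<close>, with \<open>True\<close> for the value 1.
  Since only vertices \<open>(x + 1, y + 1)\<close> have two incoming edges, the values of \<open>\<xi>\<close> on the
  boundary are never used, and an edge into a boundary vertex is both minimal and maximal.\<close>

definition edge_less :: "(vertex \<Rightarrow> bool) \<Rightarrow> edge \<Rightarrow> edge \<Rightarrow> bool" where
  "edge_less \<xi> e f \<longleftrightarrow> (\<exists>x y.
     let v = (x + 1, y + 1); a = ((x, y + 1), v); b = ((x + 1, y), v)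
     in if \<xi> v then e = a \<and> f = b else e = b \<and> f = a)"

definition maximal_edge :: "(vertex \<Rightarrow> bool) \<Rightarrow> edge \<Rightarrow> bool" where
  "maximal_edge \<xi> e \<longleftrightarrow> \<not> (\<exists>f\<in>pascal_edges. edge_less \<xi> e f)"

definition minimal_edge :: "(vertex \<Rightarrow> bool) \<Rightarrow> edge \<Rightarrow> bool" where
  "minimal_edge \<xi> e \<longleftrightarrow> \<not> (\<exists>f\<in>pascal_edges. edge_less \<xi> f e)"

definition path_less :: "(vertex \<Rightarrow> bool) \<Rightarrow> path \<Rightarrow> path \<Rightarrow> bool" where
  "path_less \<xi> \<gamma> \<eta> \<longleftrightarrow>
     (\<exists>n. \<gamma> n \<noteq> \<eta> n \<and> (\<forall>m>n. \<gamma> m = \<eta> m) \<and> edge_less \<xi> (\<gamma> n) (\<eta> n))"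

definition smallest_larger :: "(vertex \<Rightarrow> bool) \<Rightarrow> path \<Rightarrow> path \<Rightarrow> bool" where
  "smallest_larger \<xi> \<gamma> \<eta> \<longleftrightarrow> \<eta> \<in> paths \<and> path_less \<xi> \<gamma> \<eta> \<and>
     (\<forall>\<zeta>\<in>paths. path_less \<xi> \<gamma> \<zeta> \<longrightarrow> \<eta> = \<zeta> \<or> path_less \<xi> \<eta> \<zeta>)"

text \<open>The adic transformation \<open>T\<^sub>\<xi>\<close> and its inverse are partial maps; \<open>None\<close> means undefined.\<close>

definition adic :: "(vertex \<Rightarrow> bool) \<Rightarrow> path \<Rightarrow> path option" where
  "adic \<xi> \<gamma> =
     (if \<forall>i. maximal_edge \<xi> (\<gamma> i) then None else Some (THE \<eta>. smallest_larger \<xi> \<gamma> \<eta>))"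

definition adic_inv :: "(vertex \<Rightarrow> bool) \<Rightarrow> path \<Rightarrow> path option" where
  "adic_inv \<xi> \<eta> =
     (if \<forall>i. minimal_edge \<xi> (\<eta> i) then None
      else Some (THE \<gamma>. \<gamma> \<in> paths \<and> adic \<xi> \<gamma> = Some \<eta>))"

definition adic_power :: "(vertex \<Rightarrow> bool) \<Rightarrow> int \<Rightarrow> path \<Rightarrow> path option" where
  "adic_power \<xi> n \<gamma> =
     (if 0 \<le> n then ((\<lambda>p. Option.bind p (adic \<xi>)) ^^ nat n) (Some \<gamma>)
      else ((\<lambda>p. Option.bind p (adic_inv \<xi>)) ^^ nat (- n)) (Some \<gamma>))"

definition cylinder :: "nat \<Rightarrow> path \<Rightarrow> path set" where
  "cylinder k \<gamma> = {\<eta> \<in> paths. \<forall>i<k. \<eta> i = \<gamma> i}"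

definition cylinder_partition :: "nat \<Rightarrow> path set set" where
  "cylinder_partition k = cylinder k ` paths"

text \<open>\<open>cylinder k \<delta>\<close> is the unique cell of \<open>cylinder_partition k\<close> containing the path \<open>\<delta>\<close>.\<close>

definition coding :: "(vertex \<Rightarrow> bool) \<Rightarrow> nat \<Rightarrow> path \<Rightarrow> int \<Rightarrow> path set option" where
  "coding \<xi> k \<gamma> n = map_option (cylinder k) (adic_power \<xi> n \<gamma>)"

definition adic_subshift :: "(vertex \<Rightarrow> bool) \<Rightarrow> nat \<Rightarrow> (int \<Rightarrow> path set) set" where
  "adic_subshift \<xi> k = {\<omega>. (\<forall>n. \<omega> n \<in> cylinder_partition k) \<and>
     (\<forall>a l. \<exists>\<gamma>\<in>paths. \<exists>j. \<forall>i<l. coding \<xi> k \<gamma> (j + int i) = Some (\<omega> (a + int i)))}"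

definition shift :: "(int \<Rightarrow> 'a) \<Rightarrow> int \<Rightarrow> 'a" where
  "shift \<omega> n = \<omega> (n + 1)"

definition adic_subshift_topology :: "(vertex \<Rightarrow> bool) \<Rightarrow> nat \<Rightarrow> (int \<Rightarrow> path set) topology" where
  "adic_subshift_topology \<xi> k =
     subtopology (product_topology (\<lambda>_. discrete_topology (cylinder_partition k)) UNIV)
       (adic_subshift \<xi> k)"

text \<open>Only forward iterates are used. For the product square of a homeomorphism of a Hausdorff
  space, which is the only case below, allowing \<open>n\<close> to be any integer or demanding \<open>n > 0\<close>
  gives an equivalent notion.\<close>

definition topologically_transitive :: "'a topology \<Rightarrow> ('a \<Rightarrow> 'a) \<Rightarrow> bool" where
  "topologically_transitive X f \<longleftrightarrow>
     (\<forall>U V. openin X U \<and> U \<noteq> {} \<and> openin X V \<and> V \<noteq> {} \<longrightarrow>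
        (\<exists>n::nat. (f ^^ n) ` U \<inter> V \<noteq> {}))"

definition topologically_weakly_mixing :: "'a topology \<Rightarrow> ('a \<Rightarrow> 'a) \<Rightarrow> bool" where
  "topologically_weakly_mixing X f \<longleftrightarrow>
     topologically_transitive (prod_topology X X) (map_prod f f)"

end

theory Submission imports Defs begin

text \<open>
  The \<open>num_paths v\<close> finite paths from the root to a vertex \<open>v\<close> of level at least \<open>k\<close>, listed in
  increasing order and recorded by their first \<open>k\<close> edges, form a word, the block of \<open>v\<close>. At an interior vertex the block
  is the concatenation of the blocks of the two sources, in the order prescribed by \<open>\<xi>\<close>. So every
  block contains copies of all earlier blocks, and the words that occur in the subshift are exactly
  the factors of the blocks (\<open>window_in_block\<close>, \<open>block_extends\<close>). Any four words occur together in the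
  block of one vertex \<open>a\<close>. Call the distances of two copies of this block inside a larger block the
  return times of \<open>a\<close>. Weak mixing asks for a common distance at which the first word is followed by
  the second and the third by the fourth; this comes down to the statement that \<^emph>\<open>every\<close> integer \<open>d\<close>
  is a difference of two return times of \<open>a\<close> (\<open>returns_differences\<close>).

  This is proved by excluding an approximate eigenvalue. For a finite set \<open>R\<close> of integers let
  \<open>frequency \<xi> a R\<close> be the frequency of the positions \<open>p + r\<close>, where \<open>p\<close> is the beginning of a copy of
  the block of \<open>a\<close> and \<open>r \<in> R\<close>, when all finite paths of the same large length have equal weight. For
  a vertex \<open>w\<close> let \<open>R w\<close> be the set of negatives of the positions of copies of \<open>a\<close> in \<open>w\<close>. The
  frequency of \<open>R w\<close> increases with \<open>w\<close> to a limit \<open>c \<le> 1\<close>. If \<open>t\<close> is a return time of \<open>w\<close>, then \<open>R w\<close>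
  and its translate by \<open>t\<close> fit together into a translate of some \<open>R v\<close>, so their union still has
  frequency at most \<open>c\<close>. In the limit, the frequency that a translation by \<open>t\<close> adds to \<open>R w\<close> is a
  seminorm on the integers, \<open>defect\<close>, and it is small at the return times of remote vertices. But if
  \<open>d\<close> is not a difference of two return times of \<open>a\<close>, then translation by \<open>d\<close> adds at least a whole
  translate of the set of copies, and the defect of \<open>d\<close> is positive.

  On the other hand the defect vanishes identically. Return times of a vertex meet the difference set
  of every infinite sequence (\<open>returns_syndetic\<close>), so the seminorm is precompact, and polynomial
  recurrence makes \<open>t choose j\<close> small for \<open>1 \<le> j \<le> m\<close> and a suitable large \<open>t\<close>
  (\<open>binomial_recurrence\<close>). The two paths around the unit square at \<open>(x, y)\<close> show that
  \<open>((x + y) choose y) + e1 * ((x + y) choose (y - 1)) + e2 * ((x + y) choose (y + 1))\<close> is a return time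
  of every vertex with smaller coordinates, where \<open>e1, e2 \<in> {0, 1}\<close> depend on the ordering. For \<open>x = t\<close> this number differs from \<open>1 + e1 * y\<close>
  by something small. Hence \<open>1\<close> or \<open>1 + y\<close> has small defect for every large \<open>y\<close>, and comparing \<open>y\<close>
  with \<open>y + 1\<close> shows that \<open>1\<close> has small defect in either case.

  The adic map enters only through positions: cofinal paths are compared by the ranks of their initial
  segments, and the \<open>n\<close>-th power of the map increases the rank by \<open>n\<close> (\<open>adic_power_iff\<close>).
\<close>

section \<open>Precompact seminorms on the integers\<close>

text \<open>Seminorms on the group of integers correspond to translation-invariant pseudometrics. The one
  used below measures how much a translation by \<open>t\<close> changes a certain set of positions.\<close>

locale int_seminorm =
  fixes \<nu> :: "int \<Rightarrow> real"
  assumes zero: "\<nu> 0 = 0"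
    and minus: "\<nu> (- t) = \<nu> t"
    and triangle: "\<nu> (s + t) \<le> \<nu> s + \<nu> t"
begin

lemma nonneg: "0 \<le> \<nu> t"
  using triangle[of t "- t"] by (simp add: zero minus)

lemma nat_mult_le: "\<nu> (int n * t) \<le> n * \<nu> t"
proof (induction n)
  case (Suc n)
  have "\<nu> (int (Suc n) * t) \<le> \<nu> (int n * t) + \<nu> t"
    using triangle[of "int n * t" t] by (simp add: algebra_simps)
  with Suc show ?case by (simp add: algebra_simps)
qed (simp add: zero)

lemma sum_le: "\<nu> (\<Sum>i\<in>A. g i) \<le> (\<Sum>i\<in>A. \<nu> (g i))"
proof (induction A rule: infinite_finite_induct)
  case (insert x A)
  then show ?case using triangle[of "g x" "sum g A"] by simp
qed (auto simp: zero)

text \<open>Recurrence of a polynomial sequence in a precompact group: all of \<open>t choose 1\<close>, \<dots>,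
  \<open>t choose m\<close> can be made small at once, with \<open>t\<close> as large as desired. The hypothesis is
  precompactness in the form that every sequence has two close terms. Induction on \<open>m\<close>: by the
  induction hypothesis there are increments \<open>n\<^sub>0, n\<^sub>1, \<dots>\<close> whose lower binomial coefficients are so
  small, relative to the sum \<open>s l\<close> of the preceding increments, that the mixed terms in
  Vandermonde's identity are negligible. Then the coefficient of order \<open>m + 1\<close> is almost additive on
  sums of consecutive increments, so two close partial sums of \<open>n\<^sub>r choose (m + 1)\<close> yield the
  required \<open>t\<close> as a difference of two of the numbers \<open>s l\<close>.\<close>

lemma binomial_recurrence:
  assumes recurrent: "\<And>(a :: nat \<Rightarrow> int) \<eta>. \<eta> > 0 \<Longrightarrow> \<exists>k l. k < l \<and> \<nu> (a l - a k) \<le> \<eta>"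
    and "\<eta> > 0"
  shows "\<exists>t\<ge>T. \<forall>j\<in>{1..m}. \<nu> (int (t choose j)) \<le> \<eta>"
  using \<open>\<eta> > 0\<close>
proof (induction m arbitrary: \<eta> T)
  case (Suc m)
  \<comment> \<open>The factor \<open>2 ^ s\<close> bounds every binomial coefficient of a difference of earlier terms,
      and \<open>2 ^ l\<close> makes the errors of all steps summable.\<close>
  define err where "err l s = \<eta> / 4 / 2 ^ l / (real (Suc m) * 2 ^ s)" for l s :: nat
  have "\<exists>s. s 0 = 0 \<and> (\<forall>l. s l + T \<le> s (Suc l) \<and>
          (\<forall>i\<in>{1..m}. \<nu> (int ((s (Suc l) - s l) choose i)) \<le> err l (s l)))"
  proof -
    have "\<exists>s. \<forall>l. (l = 0 \<longrightarrow> s l = 0) \<and> (s l + T \<le> s (Suc l) \<and>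
          (\<forall>i\<in>{1..m}. \<nu> (int ((s (Suc l) - s l) choose i)) \<le> err l (s l)))"
    proof (rule dependent_nat_choice)
      fix x l :: nat
      have "err l x > 0" using Suc.prems unfolding err_def by (auto intro!: divide_pos_pos mult_pos_pos add_pos_nonneg)
      from Suc.IH[OF this] obtain t where "t \<ge> T" "\<forall>j\<in>{1..m}. \<nu> (int (t choose j)) \<le> err l x"
        by blast
      then show "\<exists>y. (Suc l = 0 \<longrightarrow> y = 0) \<and> x + T \<le> y \<and>
          (\<forall>i\<in>{1..m}. \<nu> (int ((y - x) choose i)) \<le> err l x)"
        by (intro exI[of _ "x + t"]) auto
    qed simp
    then show ?thesis by blast
  qed
  then obtain s :: "nat \<Rightarrow> nat" where s0: "s 0 = 0"
    and s_step: "\<And>l. s l + T \<le> s (Suc l)"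
    and s_err: "\<And>l i. i \<in> {1..m} \<Longrightarrow> \<nu> (int ((s (Suc l) - s l) choose i)) \<le> err l (s l)"
    by blast
  have s_mono: "k \<le> l \<Longrightarrow> s k \<le> s l" for k l
    using lift_Suc_mono_le[of s] s_step by (meson add_leD1)
  define a where "a l = (\<Sum>r<l. int ((s (Suc r) - s r) choose Suc m))" for l
  \<comment> \<open>Only the highest coefficient has an increment term that is not small.\<close>
  define top where "top j = (if j = Suc m then 1 else 0 :: int)" for j
  have close: "\<nu> (int ((s l - s k) choose j) - top j * (a l - a k)) \<le> \<eta> / 2 * (1 - 1 / 2 ^ l)"
    if "k \<le> l" "j \<in> {1..Suc m}" for k l j
    using \<open>k \<le> l\<close>
  proof (induction l rule: dec_induct)
    case base
    show ?case using that(2) Suc.prems by (cases j) (auto simp: zero)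
  next
    case (step l)
    define n where "n = s (Suc l) - s l"
    define t where "t = s l - s k"
    have tn: "s (Suc l) - s k = n + t"
      using s_mono[OF step(1)] s_mono[of l "Suc l"] by (simp add: n_def t_def)
    define I where "I = {1..m} \<inter> {..j}"
    have split: "{..j} = insert 0 I \<union> (if j = Suc m then {Suc m} else {})"
      using that(2) by (auto simp: I_def)
    have "int ((n + t) choose j) = (\<Sum>i\<le>j. int (n choose i) * int (t choose (j - i)))"
      unfolding vandermonde[symmetric] by simp
    also have "\<dots> = int (t choose j) + (\<Sum>i\<in>I. int (n choose i) * int (t choose (j - i)))
        + top j * int (n choose Suc m)"
      unfolding split by (auto simp: top_def I_def sum.union_disjoint)
    finally have "int ((s (Suc l) - s k) choose j) - top j * (a (Suc l) - a k)
        = (int (t choose j) - top j * (a l - a k)) + (\<Sum>i\<in>I. int (n choose i) * int (t choose (j - i)))"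
      by (simp add: tn a_def n_def algebra_simps)
    then have "\<nu> (int ((s (Suc l) - s k) choose j) - top j * (a (Suc l) - a k))
        \<le> \<nu> (int (t choose j) - top j * (a l - a k))
          + \<nu> (\<Sum>i\<in>I. int (n choose i) * int (t choose (j - i)))"
      using triangle by metis
    also have "\<nu> (\<Sum>i\<in>I. int (n choose i) * int (t choose (j - i)))
        \<le> (\<Sum>i\<in>I. \<nu> (int (n choose i) * int (t choose (j - i))))"
      by (rule sum_le)
    also have "\<dots> \<le> (\<Sum>i\<in>I. 2 ^ s l * err l (s l))"
    proof (rule sum_mono)
      fix i assume i: "i \<in> I"
      have "\<nu> (int (n choose i) * int (t choose (j - i))) \<le> real (t choose (j - i)) * \<nu> (int (n choose i))"
        using nat_mult_le[of "t choose (j - i)" "int (n choose i)"] by (simp add: mult.commute)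
      also have "\<dots> \<le> 2 ^ s l * err l (s l)"
      proof (rule mult_mono)
        have "t choose (j - i) \<le> 2 ^ t" by (rule binomial_le_pow2)
        also have "\<dots> \<le> (2::nat) ^ s l" by (simp add: t_def)
        finally show "real (t choose (j - i)) \<le> 2 ^ s l"
          by (metis of_nat_le_iff of_nat_numeral of_nat_power)
      qed (use s_err i nonneg in \<open>auto simp: n_def I_def\<close>)
      finally show "\<nu> (int (n choose i) * int (t choose (j - i))) \<le> 2 ^ s l * err l (s l)" .
    qed
    also have "\<dots> = real (card I) * (\<eta> / 4 / 2 ^ l / Suc m)"
      by (simp add: err_def del: of_nat_Suc)
    also have "\<dots> \<le> Suc m * (\<eta> / 4 / 2 ^ l / Suc m)"
    proof (rule mult_right_mono)
      have "card I \<le> card {1..m}" by (rule card_mono) (auto simp: I_def)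
      then show "real (card I) \<le> real (Suc m)" by simp
    qed (use Suc.prems in simp)
    also have "\<dots> = \<eta> / 4 / 2 ^ l" by simp
    finally show ?case using step.IH by (simp add: t_def field_simps)
  qed
  obtain k l where "k < l" and kl: "\<nu> (a l - a k) \<le> \<eta> / 2"
    using recurrent[of "\<eta> / 2" a] Suc.prems by auto
  show ?case
  proof (intro exI[of _ "s l - s k"] conjI ballI)
    have "s k + T \<le> s (Suc k)" by (rule s_step)
    also have "\<dots> \<le> s l" using \<open>k < l\<close> by (intro s_mono) simp
    finally show "T \<le> s l - s k" by simp
  next
    fix j assume j: "j \<in> {1..Suc m}"
    have "\<nu> (int ((s l - s k) choose j)) \<le> \<nu> (int ((s l - s k) choose j) - top j * (a l - a k)) + \<nu> (top j * (a l - a k))"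
      using triangle[of "int ((s l - s k) choose j) - top j * (a l - a k)" "top j * (a l - a k)"] by simp
    also have "\<dots> \<le> \<eta> / 2 * (1 - 1 / 2 ^ l) + \<eta> / 2"
      using close[of k l j] \<open>k < l\<close> j kl Suc.prems by (intro add_mono) (auto simp: top_def zero)
    also have "\<dots> \<le> \<eta>" using Suc.prems by (simp add: field_simps)
    finally show "\<nu> (int ((s l - s k) choose j)) \<le> \<eta>" .
  qed
qed auto

text \<open>For fixed \<open>y\<close>, choose \<open>x\<close> by the preceding lemma, so that all \<open>x choose j\<close> with
  \<open>1 \<le> j \<le> y + 1\<close> are small. By Vandermonde \<open>(x + y) choose r\<close> is then close to \<open>y choose r\<close>, and
  the combination in the hypothesis is close to \<open>1 + e1 * y\<close>, whatever \<open>e2\<close> is. So \<open>1\<close> or \<open>1 + y\<close>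
  is small; if \<open>1\<close> is not, then two consecutive values of \<open>y\<close> show that it is small as the
  difference of \<open>y + 2\<close> and \<open>y + 1\<close>.\<close>

lemma vanishes_at_1:
  assumes recurrent: "\<And>(a :: nat \<Rightarrow> int) \<eta>. \<eta> > 0 \<Longrightarrow> \<exists>k l. k < l \<and> \<nu> (a l - a k) \<le> \<eta>"
    and flips: "\<And>\<epsilon>. \<epsilon> > 0 \<Longrightarrow> \<exists>n. \<forall>x\<ge>n. \<forall>y\<ge>n. \<exists>e1\<in>{0, 1}. \<exists>e2\<in>{0, 1}.
        \<nu> (int ((x + y) choose y) + e1 * int ((x + y) choose (y - 1))
            + e2 * int ((x + y) choose (y + 1))) \<le> \<epsilon>"
  shows "\<nu> 1 = 0"
proof -
  have *: "\<nu> 1 \<le> 4 * \<epsilon>" if eps: "\<epsilon> > 0" for \<epsilon>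
  proof -
    obtain n where n: "\<And>x y. x \<ge> n \<Longrightarrow> y \<ge> n \<Longrightarrow> \<exists>e1\<in>{0, 1}. \<exists>e2\<in>{0, 1}.
        \<nu> (int ((x + y) choose y) + e1 * int ((x + y) choose (y - 1))
            + e2 * int ((x + y) choose (y + 1))) \<le> \<epsilon>"
      using flips[OF eps] by blast
    have dich: "\<nu> 1 \<le> 2 * \<epsilon> \<or> \<nu> (1 + int y) \<le> 2 * \<epsilon>" if y: "y \<ge> n" "y \<ge> 1" for y
    proof -
      define c where "c = real (Suc (Suc y)) * 2 ^ y"
      define \<eta> where "\<eta> = \<epsilon> / 3 / c"
      have "c > 0" by (auto simp: c_def intro!: add_pos_nonneg)
      then have "\<eta> > 0" using eps by (simp add: \<eta>_def)
      from binomial_recurrence[OF recurrent this, of n "Suc y"]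
      obtain t where t: "t \<ge> n" "\<And>j. j \<in> {1..Suc y} \<Longrightarrow> \<nu> (int (t choose j)) \<le> \<eta>" by blast
      have near: "\<nu> (int ((t + y) choose r) - int (y choose r)) \<le> \<epsilon> / 3" if "r \<le> Suc y" for r
      proof -
        have "int ((t + y) choose r) = (\<Sum>i\<le>r. int (t choose i) * int (y choose (r - i)))"
          unfolding vandermonde[symmetric] by simp
        also have "{..r} = insert 0 {1..r}" by auto
        also have "(\<Sum>i\<in>insert 0 {1..r}. int (t choose i) * int (y choose (r - i)))
            = int (y choose r) + (\<Sum>i=1..r. int (t choose i) * int (y choose (r - i)))"
          by (subst sum.insert) auto
        finally have "\<nu> (int ((t + y) choose r) - int (y choose r))
            = \<nu> (\<Sum>i=1..r. int (t choose i) * int (y choose (r - i)))" by simp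
        also have "\<dots> \<le> (\<Sum>i=1..r. \<nu> (int (t choose i) * int (y choose (r - i))))"
          by (rule sum_le)
        also have "\<dots> \<le> (\<Sum>i=1..r. 2 ^ y * \<eta>)"
        proof (rule sum_mono)
          fix i assume i: "i \<in> {1..r}"
          have "\<nu> (int (t choose i) * int (y choose (r - i))) \<le> real (y choose (r - i)) * \<nu> (int (t choose i))"
            using nat_mult_le[of "y choose (r - i)" "int (t choose i)"] by (simp add: mult.commute)
          also have "\<dots> \<le> 2 ^ y * \<eta>"
          proof (rule mult_mono)
            have "y choose (r - i) \<le> 2 ^ y" by (rule binomial_le_pow2)
            then show "real (y choose (r - i)) \<le> 2 ^ y"
              by (metis of_nat_le_iff of_nat_numeral of_nat_power)
          qed (use t i that nonneg in auto)
          finally show "\<nu> (int (t choose i) * int (y choose (r - i))) \<le> 2 ^ y * \<eta>" .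
        qed
        also have "\<dots> = r * (2 ^ y * \<eta>)" by simp
        also have "\<dots> \<le> Suc (Suc y) * (2 ^ y * \<eta>)"
          using that \<open>\<eta> > 0\<close> by (intro mult_right_mono) auto
        also have "\<dots> = c * \<eta>" by (simp only: c_def mult.assoc)
        also have "\<dots> = \<epsilon> / 3" using \<open>c > 0\<close> by (simp add: \<eta>_def)
        finally show ?thesis .
      qed
      obtain e1 e2 :: int where e: "e1 \<in> {0, 1}" "e2 \<in> {0, 1}"
        "\<nu> (int ((t + y) choose y) + e1 * int ((t + y) choose (y - 1))
            + e2 * int ((t + y) choose (y + 1))) \<le> \<epsilon>"
        using n[OF t(1) y(1)] by blast
      let ?A = "int ((t + y) choose y) - 1" and ?B = "int ((t + y) choose (y - 1)) - int y"
        and ?C = "int ((t + y) choose (y + 1))"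
      have y1: "y choose (y - 1) = y"
        using binomial_symmetric[of 1 y] y(2) by simp
      have A: "\<nu> ?A \<le> \<epsilon> / 3" using near[of y] by simp
      have B: "\<nu> (e1 * ?B) \<le> \<epsilon> / 3" using near[of "y - 1", unfolded y1] e(1) \<open>\<epsilon> > 0\<close> by (auto simp: zero)
      have C: "\<nu> (e2 * ?C) \<le> \<epsilon> / 3" using near[of "y + 1"] e(2) \<open>\<epsilon> > 0\<close> by (auto simp: zero binomial_eq_0)
      have "1 + e1 * int y = (int ((t + y) choose y) + e1 * int ((t + y) choose (y - 1))
            + e2 * int ((t + y) choose (y + 1))) + (- ?A + (- (e1 * ?B) + - (e2 * ?C)))"
        by (simp add: algebra_simps)
      then have "\<nu> (1 + e1 * int y) \<le> \<epsilon> + \<nu> (- ?A + (- (e1 * ?B) + - (e2 * ?C)))"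
        using triangle e(3) by (smt (verit))
      also have "\<nu> (- ?A + (- (e1 * ?B) + - (e2 * ?C))) \<le> \<nu> (- ?A) + (\<nu> (- (e1 * ?B)) + \<nu> (- (e2 * ?C)))"
        using triangle by (smt (verit))
      also have "\<dots> \<le> \<epsilon>"
        using A B C unfolding minus by simp
      finally have "\<nu> (1 + e1 * int y) \<le> 2 * \<epsilon>" by simp
      then show ?thesis using e(1) by auto
    qed
    have "\<nu> 1 \<le> \<nu> (1 + int (Suc (Suc n))) + \<nu> (1 + int (Suc n))"
      using triangle[of "1 + int (Suc (Suc n))" "- (1 + int (Suc n))"] by (simp only: minus) simp
    then show ?thesis
      using dich[of "Suc n"] dich[of "Suc (Suc n)"] \<open>\<epsilon> > 0\<close> by auto
  qed
  have "\<nu> 1 \<le> 0"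
  proof (rule field_le_epsilon)
    fix e :: real assume "e > 0"
    then show "\<nu> 1 \<le> 0 + e" using *[of "e / 4"] by simp
  qed
  with nonneg[of 1] show ?thesis by simp
qed

lemma vanishes:
  assumes "\<nu> 1 = 0"
  shows "\<nu> t = 0"
proof -
  have "\<nu> (int n) = 0" for n using nat_mult_le[of n 1] assms nonneg[of "int n"] by simp
  then show ?thesis by (cases t rule: int_cases2) (auto simp: minus)
qed

end

section \<open>Edges, offsets and levels\<close>

definition num_paths :: "vertex \<Rightarrow> nat" where
  "num_paths v = (fst v + snd v) choose snd v"

lemma num_paths_simps [simp]:
  "num_paths (0, y) = 1" "num_paths (x, 0) = 1"
  "num_paths (Suc x, Suc y) = num_paths (x, Suc y) + num_paths (Suc x, y)"
  by (simp_all add: num_paths_def)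

lemma num_paths_pos: "num_paths v > 0"
  by (cases v) (simp add: num_paths_def)

text \<open>The finite paths ending at \<open>v\<close> that use a given last edge are consecutive in the order of all
  finite paths ending at \<open>v\<close>; the offset of the edge is the number of paths that precede them. It is
  \<open>0\<close> for a minimal edge and the number of paths to the other source otherwise.\<close>

fun edge_offset :: "(vertex \<Rightarrow> bool) \<Rightarrow> edge \<Rightarrow> nat" where
  "edge_offset \<xi> ((x, y), (x', y')) =
     (if x = x' then if x' > 0 \<and> \<xi> (x', y') then num_paths (x' - 1, y') else 0
      else if y' > 0 \<and> \<not> \<xi> (x', y') then num_paths (x', y' - 1) else 0)"

lemma pascal_edges_iff:
  "((x, y), (x', y')) \<in> pascal_edges \<longleftrightarrow> x' = Suc x \<and> y' = y \<or> x' = x \<and> y' = Suc y"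
  by (auto simp: pascal_edges_def)

lemma sources_eq:
  "{u. (u, (x, y)) \<in> pascal_edges} =
     (if x > 0 then {(x - 1, y)} else {}) \<union> (if y > 0 then {(x, y - 1)} else {})"
  by (auto simp: pascal_edges_iff)

lemma finite_sources [simp]: "finite {u. (u, v) \<in> pascal_edges}"
  by (cases v) (simp add: sources_eq)

text \<open>The entering edges of an interior vertex are named by their order instead of their direction, so
  that no case distinction on \<open>\<xi>\<close> remains in later arguments.\<close>

lemma interior_sources:
  obtains u1 u2 where "{u. (u, (Suc x, Suc y)) \<in> pascal_edges} = {u1, u2}" "u1 \<noteq> u2"
    "edge_offset \<xi> (u1, (Suc x, Suc y)) = 0"
    "edge_offset \<xi> (u2, (Suc x, Suc y)) = num_paths u1"
    "num_paths (Suc x, Suc y) = num_paths u1 + num_paths u2"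
    "edge_less \<xi> (u1, (Suc x, Suc y)) (u2, (Suc x, Suc y))"
proof -
  let ?v = "(Suc x, Suc y)" and ?l = "(x, Suc y)" and ?d = "(Suc x, y)"
  have less: "edge_less \<xi> (?l, ?v) (?d, ?v) \<longleftrightarrow> \<xi> ?v" "edge_less \<xi> (?d, ?v) (?l, ?v) \<longleftrightarrow> \<not> \<xi> ?v"
    unfolding edge_less_def Let_def by auto
  have src: "{u. (u, ?v) \<in> pascal_edges} = {?l, ?d}" by (auto simp: sources_eq)
  show ?thesis
  proof (cases "\<xi> ?v")
    case True
    with src less show ?thesis by (intro that[of ?l ?d]) simp_all
  next
    case False
    with src less show ?thesis by (intro that[of ?d ?l]) (simp_all add: insert_commute)
  qed
qed

lemma edge_offset_boundary:
  assumes "(u, (x, y)) \<in> pascal_edges" "x = 0 \<or> y = 0"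
  shows "edge_offset \<xi> (u, (x, y)) = 0" "num_paths u = num_paths (x, y)"
  using assms by (cases u; auto simp: pascal_edges_iff)+

lemma edge_offset_bound:
  assumes "(u, v) \<in> pascal_edges"
  shows "edge_offset \<xi> (u, v) + num_paths u \<le> num_paths v"
proof -
  obtain a b x y where uv: "u = (a, b)" "v = (x, y)" by fastforce
  then have "x = Suc a \<and> y = b \<or> x = a \<and> y = Suc b" using assms by (simp add: pascal_edges_iff)
  then show ?thesis unfolding uv by (cases a; cases b) auto
qed

text \<open>The blocks of the two sources occupy disjoint intervals of the block of their common target.\<close>

lemma edge_offset_disjoint:
  assumes "(u, v) \<in> pascal_edges" "(u', v) \<in> pascal_edges" "u \<noteq> u'"
  shows "edge_offset \<xi> (u, v) + num_paths u \<le> edge_offset \<xi> (u', v)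
    \<or> edge_offset \<xi> (u', v) + num_paths u' \<le> edge_offset \<xi> (u, v)"
proof -
  obtain a b c d x y where uv: "u = (a, b)" "u' = (c, d)" "v = (x, y)" by fastforce
  then have "x = Suc a \<and> y = b \<and> x = c \<and> y = Suc d \<or> x = a \<and> y = Suc b \<and> x = Suc c \<and> y = d"
    using assms by (auto simp: pascal_edges_iff)
  then show ?thesis unfolding uv by auto
qed

definition level :: "vertex \<Rightarrow> nat" where
  "level v = fst v + snd v"

lemma level_edge: "(u, v) \<in> pascal_edges \<Longrightarrow> level v = Suc (level u)"
  by (cases u; cases v) (auto simp: pascal_edges_iff level_def)

text \<open>All \<open>2 ^ N\<close> finite paths of length \<open>N\<close> are counted with equal weight by summing over the
  \<open>N + 1\<close> vertices of level \<open>N\<close>. Since every vertex is the source of exactly two edges, passing from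
  the vertices of one level to the sources of the next level doubles the sum.\<close>

definition level_sum :: "(vertex \<Rightarrow> real) \<Rightarrow> nat \<Rightarrow> real" where
  "level_sum \<Phi> N = (\<Sum>i\<le>N. \<Phi> (i, N - i))"

lemma level_sum_mono:
  assumes "\<And>v. level v = N \<Longrightarrow> \<Phi> v \<le> \<Psi> v"
  shows "level_sum \<Phi> N \<le> level_sum \<Psi> N"
  unfolding level_sum_def by (intro sum_mono assms) (simp add: level_def)

lemma level_sum_nonneg: "(\<And>v. 0 \<le> \<Phi> v) \<Longrightarrow> 0 \<le> level_sum \<Phi> N"
  unfolding level_sum_def by (intro sum_nonneg) auto

lemma level_sum_add: "level_sum (\<lambda>v. \<Phi> v + \<Psi> v) N = level_sum \<Phi> N + level_sum \<Psi> N"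
  by (simp add: level_sum_def sum.distrib)

lemma level_sum_const: "level_sum (\<lambda>_. c) N = (N + 1) * c"
  by (simp add: level_sum_def)

lemma level_sum_sources: "level_sum (\<lambda>v. \<Sum>u | (u, v) \<in> pascal_edges. \<Phi> u) (Suc N) = 2 * level_sum \<Phi> N"
proof -
  have "(\<Sum>u | (u, (i, j)) \<in> pascal_edges. \<Phi> u)
      = (if i > 0 then \<Phi> (i - 1, j) else 0) + (if j > 0 then \<Phi> (i, j - 1) else 0)" for i j
    unfolding sources_eq by auto
  then have "level_sum (\<lambda>v. \<Sum>u | (u, v) \<in> pascal_edges. \<Phi> u) (Suc N)
      = (\<Sum>i\<le>Suc N. if i > 0 then \<Phi> (i - 1, Suc N - i) else 0)
        + (\<Sum>i\<le>Suc N. if Suc N - i > 0 then \<Phi> (i, Suc N - i - 1) else 0)"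
    by (simp add: level_sum_def sum.distrib)
  also have "(\<Sum>i\<le>Suc N. if i > 0 then \<Phi> (i - 1, Suc N - i) else 0) = level_sum \<Phi> N"
    by (subst sum.atMost_Suc_shift) (simp add: level_sum_def)
  also have "(\<Sum>i\<le>Suc N. if Suc N - i > 0 then \<Phi> (i, Suc N - i - 1) else 0) = level_sum \<Phi> N"
    unfolding sum.atMost_Suc level_sum_def by (auto intro!: sum.cong)
  finally show ?thesis by simp
qed

lemma level_sum_num_paths: "level_sum (\<lambda>v. real (num_paths v)) N = 2 ^ N"
proof -
  have "level_sum (\<lambda>v. real (num_paths v)) N = (\<Sum>i\<le>N. real (N choose i))"
    by (auto simp: level_sum_def num_paths_def binomial_symmetric[symmetric] intro!: sum.cong)
  also have "\<dots> = 2 ^ N"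
    using choose_row_sum[of N] by (metis of_nat_numeral of_nat_power of_nat_sum)
  finally show ?thesis .
qed

section \<open>Copies of blocks and return times\<close>

text \<open>The finite paths to \<open>a\<close>, in increasing order and all prolonged by the same path from \<open>a\<close> to
  \<open>v\<close>, form an interval in the ordered list of all finite paths to \<open>v\<close>. The offset \<open>s\<close> is the starting
  point of this interval; it is the sum of the edge offsets along the prolongation.\<close>

inductive copy :: "(vertex \<Rightarrow> bool) \<Rightarrow> vertex \<Rightarrow> vertex \<Rightarrow> nat \<Rightarrow> bool" for \<xi> a where
  self: "copy \<xi> a a 0"
| step: "copy \<xi> a u s \<Longrightarrow> (u, v) \<in> pascal_edges \<Longrightarrow> copy \<xi> a v (s + edge_offset \<xi> (u, v))"

lemma copy_bound: "copy \<xi> a v s \<Longrightarrow> s + num_paths a \<le> num_paths v"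
proof (induction rule: copy.induct)
  case (step u s v)
  then show ?case using edge_offset_bound[of u v \<xi>] by linarith
qed simp

lemma copy_ge: "copy \<xi> a v s \<Longrightarrow> fst a \<le> fst v \<and> snd a \<le> snd v"
proof (induction rule: copy.induct)
  case (step u s v)
  then show ?case by (cases u; cases v) (auto simp: pascal_edges_iff)
qed simp

lemma copy_level: "copy \<xi> a v s \<Longrightarrow> level a \<le> level v"
  using copy_ge[of \<xi> a v s] by (simp add: level_def)

lemma copy_trans: "copy \<xi> b v t \<Longrightarrow> copy \<xi> a b s \<Longrightarrow> copy \<xi> a v (s + t)"
proof (induction rule: copy.induct)
  case (step u t v)
  then show ?case using copy.step[of \<xi> a u "s + t" v] by (simp add: add.assoc)
qed simp

lemma copy_exists:
  assumes "fst a \<le> fst v" "snd a \<le> snd v"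
  shows "\<exists>s. copy \<xi> a v s"
proof -
  obtain x y where a: "a = (x, y)" by fastforce
  have 1: "\<exists>s. copy \<xi> (x, y) (x + i, y) s" for i
  proof (induction i)
    case (Suc i)
    then show ?case using copy.step[of \<xi> _ "(x + i, y)" _ "(x + Suc i, y)"]
      by (auto simp: pascal_edges_iff)
  qed (auto intro: copy.self)
  have 2: "\<exists>s. copy \<xi> (x, y) (x + i, y + j) s" for i j
  proof (induction j)
    case (Suc j)
    then show ?case using copy.step[of \<xi> _ "(x + i, y + j)" _ "(x + i, y + Suc j)"]
      by (auto simp: pascal_edges_iff)
  qed (use 1 in simp)
  show ?thesis using 2[of "fst v - x" "snd v - y"] assms by (simp add: a)
qed

definition returns :: "(vertex \<Rightarrow> bool) \<Rightarrow> vertex \<Rightarrow> int set" where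
  "returns \<xi> a = {int t - int s | s t. \<exists>v. copy \<xi> a v s \<and> copy \<xi> a v t}"

lemma returnsI: "copy \<xi> a v s \<Longrightarrow> copy \<xi> a v t \<Longrightarrow> int t - int s \<in> returns \<xi> a"
  unfolding returns_def by blast

lemma returns_antimono:
  assumes "fst a \<le> fst b" "snd a \<le> snd b"
  shows "returns \<xi> b \<subseteq> returns \<xi> a"
proof -
  obtain r where r: "copy \<xi> a b r" using copy_exists[OF assms] by blast
  show ?thesis
  proof
    fix d assume "d \<in> returns \<xi> b"
    then obtain s t v where "copy \<xi> b v s" "copy \<xi> b v t" "d = int t - int s"
      by (auto simp: returns_def)
    then show "d \<in> returns \<xi> a"
      using returnsI[OF copy_trans[OF _ r] copy_trans[OF _ r], of v s t] by simp
  qed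
qed

lemma returns_add:
  assumes a: "copy \<xi> a v s" "copy \<xi> a v t" and v: "r \<in> returns \<xi> v"
  shows "int t - int s + r \<in> returns \<xi> a"
proof -
  obtain p q w where "copy \<xi> v w p" "copy \<xi> v w q" "r = int q - int p"
    using v by (auto simp: returns_def)
  then have "int (t + q) - int (s + p) \<in> returns \<xi> a"
    by (intro returnsI[OF copy_trans[OF _ a(1)] copy_trans[OF _ a(2)]])
  also have "int (t + q) - int (s + p) = int t - int s + r"
    using \<open>r = int q - int p\<close> by simp
  finally show ?thesis .
qed

text \<open>The two paths around a unit square. The distance of the two copies obtained in this way is
  the length of the first copy plus the length of what the ordering puts between them: nothing, the
  block of one of the two neighbours of the starting vertex on its level, or both.\<close>

lemma square_return:
  assumes "fst a \<le> Suc x" "snd a \<le> Suc y"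
  shows "\<exists>e1\<in>{0, 1}. \<exists>e2\<in>{0, 1}. int (num_paths (Suc x, Suc y))
      + e1 * int (num_paths (Suc (Suc x), y)) + e2 * int (num_paths (x, Suc (Suc y))) \<in> returns \<xi> a"
proof -
  let ?o = "(Suc x, Suc y)" and ?r = "(Suc (Suc x), Suc y)" and ?u = "(Suc x, Suc (Suc y))"
    and ?v = "(Suc (Suc x), Suc (Suc y))"
  have edges: "(?o, ?r) \<in> pascal_edges" "(?r, ?v) \<in> pascal_edges"
    "(?o, ?u) \<in> pascal_edges" "(?u, ?v) \<in> pascal_edges"
    by (auto simp: pascal_edges_iff)
  note c1 = copy.step[OF copy.step[OF copy.self edges(1)] edges(2), of \<xi>]
  note c2 = copy.step[OF copy.step[OF copy.self edges(3)] edges(4), of \<xi>]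
  define e1 e2 :: int where "e1 = (if \<xi> ?r = \<xi> ?v then 0 else 1)"
    and "e2 = (if \<xi> ?u = \<xi> ?v then 0 else 1)"
  let ?d = "int (num_paths ?o) + e1 * int (num_paths (Suc (Suc x), y)) + e2 * int (num_paths (x, Suc (Suc y)))"
  have "?d \<in> returns \<xi> ?o"
    using returnsI[OF c1 c2] returnsI[OF c2 c1]
    by (cases "\<xi> ?v"; cases "\<xi> ?r"; cases "\<xi> ?u") (simp_all add: e1_def e2_def algebra_simps)
  moreover have "returns \<xi> ?o \<subseteq> returns \<xi> a" using assms by (intro returns_antimono) auto
  ultimately show ?thesis
    by (intro bexI[of _ e1] bexI[of _ e2]) (auto simp: e1_def e2_def)
qed

section \<open>Frequencies of sets of positions\<close>

definition positions :: "(vertex \<Rightarrow> bool) \<Rightarrow> vertex \<Rightarrow> vertex \<Rightarrow> int set" where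
  "positions \<xi> a v = {int s | s. copy \<xi> a v s}"

lemma positions_bounds: "positions \<xi> a v \<subseteq> {0..<int (num_paths v)}"
proof
  fix p assume "p \<in> positions \<xi> a v"
  then obtain s where "copy \<xi> a v s" "p = int s" unfolding positions_def by blast
  then show "p \<in> {0..<int (num_paths v)}"
    using copy_bound[of \<xi> a v s] num_paths_pos[of a] by simp
qed

lemma finite_positions [simp]: "finite (positions \<xi> a v)"
  by (rule finite_subset[OF positions_bounds]) simp

lemma positions_self: "0 \<in> positions \<xi> a a"
  unfolding positions_def using copy.self[of \<xi> a] by fastforce

lemma positions_source:
  "(u, v) \<in> pascal_edges \<Longrightarrow> (\<lambda>p. p + int (edge_offset \<xi> (u, v))) ` positions \<xi> a u \<subseteq> positions \<xi> a v"
  using copy.step[of \<xi> a u _ v] by (force simp: positions_def)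

lemma positions_step:
  assumes "v \<noteq> a"
  shows "positions \<xi> a v =
    (\<Union>u\<in>{u. (u, v) \<in> pascal_edges}. (\<lambda>p. p + int (edge_offset \<xi> (u, v))) ` positions \<xi> a u)"
  (is "_ = ?U")
proof
  show "?U \<subseteq> positions \<xi> a v"
    by (rule UN_least, rule positions_source, erule CollectD)
next
  show "positions \<xi> a v \<subseteq> ?U"
  proof
    fix p assume "p \<in> positions \<xi> a v"
    then obtain s where s: "copy \<xi> a v s" "p = int s" unfolding positions_def by blast
    obtain u t where u: "copy \<xi> a u t" "(u, v) \<in> pascal_edges" "s = t + edge_offset \<xi> (u, v)"
      using s(1) assms by (rule_tac copy.cases[OF s(1)]) blast+
    have "int t \<in> positions \<xi> a u" unfolding positions_def using u(1) by blast
    moreover have "p = int t + int (edge_offset \<xi> (u, v))" by (simp only: s u(3) of_nat_add)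
    ultimately show "p \<in> ?U"
      by (intro UN_I[of u] image_eqI[of _ _ "int t"] CollectI u(2))
  qed
qed

definition translate :: "int \<Rightarrow> int set \<Rightarrow> int set" where
  "translate t R = (\<lambda>r. r + t) ` R"

lemma finite_translate [simp]: "finite R \<Longrightarrow> finite (translate t R)"
  by (simp add: translate_def)

lemma translate_Un: "translate t (A \<union> B) = translate t A \<union> translate t B"
  by (simp add: translate_def image_Un)

lemma translate_mono: "A \<subseteq> B \<Longrightarrow> translate t A \<subseteq> translate t B"
  by (auto simp: translate_def)

lemma translate_translate: "translate s (translate t R) = translate (t + s) R"
  by (simp add: translate_def image_image add.assoc)

lemma translate_0 [simp]: "translate 0 R = R"
  by (simp add: translate_def)

text \<open>The union of the translates by \<open>r \<in> R\<close> of the set of starting points of copies. Positions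
  outside the block of \<open>v\<close> are kept, which makes translation invariance exact; in the limit below
  they do not matter.\<close>

definition spread :: "(vertex \<Rightarrow> bool) \<Rightarrow> vertex \<Rightarrow> int set \<Rightarrow> vertex \<Rightarrow> int set" where
  "spread \<xi> a R v = (\<Union>r\<in>R. (\<lambda>p. p + r) ` positions \<xi> a v)"

lemma finite_spread [simp]: "finite R \<Longrightarrow> finite (spread \<xi> a R v)"
  by (simp add: spread_def)

lemma spread_Un: "spread \<xi> a (A \<union> B) v = spread \<xi> a A v \<union> spread \<xi> a B v"
  by (auto simp: spread_def)

lemma spread_mono: "A \<subseteq> B \<Longrightarrow> spread \<xi> a A v \<subseteq> spread \<xi> a B v"
  by (auto simp: spread_def)

lemma spread_translate: "spread \<xi> a (translate t R) v = translate t (spread \<xi> a R v)"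
  by (auto simp: spread_def translate_def image_UN image_image add.assoc)

lemma spread_0: "spread \<xi> a {0} v = positions \<xi> a v"
  by (simp add: spread_def)

text \<open>The average of \<open>spread\<close> over all finite paths of length \<open>N\<close>. Its limit is the value that the
  invariant measure with equal weights on all edges would give to this set of positions; working with
  frequencies instead avoids constructing the measure.\<close>

definition frequency_at :: "(vertex \<Rightarrow> bool) \<Rightarrow> vertex \<Rightarrow> int set \<Rightarrow> nat \<Rightarrow> real" where
  "frequency_at \<xi> a R N = level_sum (\<lambda>v. real (card (spread \<xi> a R v))) N / 2 ^ N"

definition frequency :: "(vertex \<Rightarrow> bool) \<Rightarrow> vertex \<Rightarrow> int set \<Rightarrow> real" where
  "frequency \<xi> a R = lim (frequency_at \<xi> a R)"

text \<open>Beyond the level of \<open>a\<close> every copy in the block of \<open>v\<close> lies in a copy of the block of a source,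
  so \<open>spread\<close> at \<open>v\<close> is a union of translates of \<open>spread\<close> at the sources. Overlaps at the junction can
  only decrease the count, hence the averages decrease and converge.\<close>

lemma frequency_at_Suc_le:
  assumes "finite R" "level a \<le> N"
  shows "frequency_at \<xi> a R (Suc N) \<le> frequency_at \<xi> a R N"
proof -
  have "level_sum (\<lambda>v. real (card (spread \<xi> a R v))) (Suc N)
      \<le> level_sum (\<lambda>v. \<Sum>u | (u, v) \<in> pascal_edges. real (card (spread \<xi> a R u))) (Suc N)"
  proof (rule level_sum_mono)
    fix v assume "level v = Suc N"
    then have "v \<noteq> a" using assms(2) by auto
    have "spread \<xi> a R v = (\<Union>u\<in>{u. (u, v) \<in> pascal_edges}.
        (\<lambda>p. p + int (edge_offset \<xi> (u, v))) ` spread \<xi> a R u)"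
      unfolding spread_def positions_step[OF \<open>v \<noteq> a\<close>] image_UN image_image
      by (subst SUP_commute) (simp add: ac_simps)
    also have "card \<dots> \<le> (\<Sum>u | (u, v) \<in> pascal_edges.
        card ((\<lambda>p. p + int (edge_offset \<xi> (u, v))) ` spread \<xi> a R u))"
      by (rule card_UN_le) simp
    also have "\<dots> = (\<Sum>u | (u, v) \<in> pascal_edges. card (spread \<xi> a R u))"
      by (intro sum.cong card_image) (auto simp: inj_on_def)
    finally show "real (card (spread \<xi> a R v)) \<le> (\<Sum>u | (u, v) \<in> pascal_edges. real (card (spread \<xi> a R u)))"
      by (metis of_nat_le_iff of_nat_sum)
  qed
  also have "\<dots> = 2 * level_sum (\<lambda>v. real (card (spread \<xi> a R v))) N"
    by (rule level_sum_sources)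
  finally show ?thesis by (simp add: frequency_at_def field_simps)
qed

lemma frequency_at_tendsto:
  assumes "finite R"
  shows "frequency_at \<xi> a R \<longlonglongrightarrow> frequency \<xi> a R"
proof -
  have "decseq (\<lambda>N. frequency_at \<xi> a R (N + level a))"
    using frequency_at_Suc_le[OF assms, of a _ \<xi>] by (intro decseq_SucI) simp
  moreover have "0 \<le> frequency_at \<xi> a R N" for N
    unfolding frequency_at_def by (simp add: level_sum_nonneg)
  ultimately obtain L where "(\<lambda>N. frequency_at \<xi> a R (N + level a)) \<longlonglongrightarrow> L"
    using decseq_convergent by metis
  then have "frequency_at \<xi> a R \<longlonglongrightarrow> L" by (rule LIMSEQ_offset)
  then show ?thesis unfolding frequency_def by (simp add: limI)
qed

lemma frequency_le:
  assumes "finite A" "finite B" and le: "\<And>v. card (spread \<xi> a A v) \<le> card (spread \<xi> a B v)"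
  shows "frequency \<xi> a A \<le> frequency \<xi> a B"
proof (rule LIMSEQ_le[OF frequency_at_tendsto frequency_at_tendsto])
  show "\<exists>N. \<forall>n\<ge>N. frequency_at \<xi> a A n \<le> frequency_at \<xi> a B n"
    unfolding frequency_at_def using le
    by (intro exI allI impI divide_right_mono level_sum_mono of_nat_mono) simp_all
qed (use assms in auto)

lemma frequency_add_le:
  assumes fin: "finite A" "finite B" "finite C" "finite D"
    and le: "\<And>v. card (spread \<xi> a A v) + card (spread \<xi> a B v) \<le> card (spread \<xi> a C v) + card (spread \<xi> a D v)"
  shows "frequency \<xi> a A + frequency \<xi> a B \<le> frequency \<xi> a C + frequency \<xi> a D"
proof (rule LIMSEQ_le[OF tendsto_add[OF frequency_at_tendsto frequency_at_tendsto]
      tendsto_add[OF frequency_at_tendsto frequency_at_tendsto]])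
  show "\<exists>N. \<forall>n\<ge>N. frequency_at \<xi> a A n + frequency_at \<xi> a B n \<le> frequency_at \<xi> a C n + frequency_at \<xi> a D n"
  proof (intro exI allI impI)
    fix n
    have "level_sum (\<lambda>v. real (card (spread \<xi> a A v)) + real (card (spread \<xi> a B v))) n
        \<le> level_sum (\<lambda>v. real (card (spread \<xi> a C v)) + real (card (spread \<xi> a D v))) n"
      by (rule level_sum_mono) (metis le of_nat_add of_nat_le_iff)
    then show "frequency_at \<xi> a A n + frequency_at \<xi> a B n \<le> frequency_at \<xi> a C n + frequency_at \<xi> a D n"
      unfolding frequency_at_def add_divide_distrib[symmetric] level_sum_add[symmetric]
      by (rule divide_right_mono) simp
  qed
qed (use fin in auto)

lemma frequency_mono: "finite B \<Longrightarrow> A \<subseteq> B \<Longrightarrow> frequency \<xi> a A \<le> frequency \<xi> a B"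
  using finite_subset[of A B] by (intro frequency_le card_mono finite_spread spread_mono)

lemma frequency_translate:
  assumes "finite R"
  shows "frequency \<xi> a (translate t R) = frequency \<xi> a R"
proof -
  have "card (spread \<xi> a (translate t R) v) = card (spread \<xi> a R v)" for v
    unfolding spread_translate by (simp add: translate_def card_image inj_on_def)
  then show ?thesis using assms by (intro antisym frequency_le) auto
qed

lemma frequency_submodular:
  assumes "finite A" "finite B" "C \<subseteq> A" "C \<subseteq> B"
  shows "frequency \<xi> a (A \<union> B) + frequency \<xi> a C \<le> frequency \<xi> a A + frequency \<xi> a B"
proof (rule frequency_add_le)
  fix v
  let ?X = "\<lambda>R. spread \<xi> a R v"
  have "card (?X C) \<le> card (?X A \<inter> ?X B)"
    using assms by (intro card_mono Int_greatest spread_mono) auto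
  then show "card (?X (A \<union> B)) + card (?X C) \<le> card (?X A) + card (?X B)"
    using card_Un_Int[of "?X A" "?X B"] assms by (simp add: spread_Un)
qed (use assms finite_subset[of C A] in auto)

lemma frequency_empty: "frequency \<xi> a {} = 0"
proof -
  have "frequency_at \<xi> a {} = (\<lambda>_. 0)"
    by (simp add: fun_eq_iff frequency_at_def spread_def level_sum_def)
  then show ?thesis by (simp add: frequency_def limI)
qed

lemma frequency_disjoint:
  assumes "finite A" "finite B" "\<And>v. spread \<xi> a A v \<inter> spread \<xi> a B v = {}"
  shows "frequency \<xi> a A + frequency \<xi> a B \<le> frequency \<xi> a (A \<union> B)"
proof -
  have "frequency \<xi> a A + frequency \<xi> a B \<le> frequency \<xi> a (A \<union> B) + frequency \<xi> a {}"
    using assms by (intro frequency_add_le) (auto simp: spread_Un card_Un_disjoint)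
  then show ?thesis by (simp add: frequency_empty)
qed

lemma sum_card_positions_ge:
  "2 ^ n \<le> level_sum (\<lambda>v. real (card (positions \<xi> a v))) (level a + n)"
proof (induction n)
  case 0
  have "(\<Sum>i\<in>{fst a}. real (card (positions \<xi> a (i, level a - i))))
      \<le> (\<Sum>i\<le>level a. real (card (positions \<xi> a (i, level a - i))))"
    by (rule sum_mono2) (auto simp: level_def)
  moreover have "card (positions \<xi> a a) \<ge> 1"
    using positions_self[of \<xi> a] card_gt_0_iff[of "positions \<xi> a a"] by fastforce
  ultimately show ?case by (simp add: level_sum_def level_def)
next
  case (Suc n)
  have "level_sum (\<lambda>v. \<Sum>u | (u, v) \<in> pascal_edges. real (card (positions \<xi> a u))) (Suc (level a + n))
      \<le> level_sum (\<lambda>v. real (card (positions \<xi> a v))) (Suc (level a + n))"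
  proof (rule level_sum_mono)
    fix v :: vertex
    let ?Q = "\<lambda>u. (\<lambda>p. p + int (edge_offset \<xi> (u, v))) ` positions \<xi> a u"
    have dis: "?Q u \<inter> ?Q u' = {}" if "(u, v) \<in> pascal_edges" "(u', v) \<in> pascal_edges" "u \<noteq> u'" for u u'
    proof -
      have "q + int (edge_offset \<xi> (u, v)) \<noteq> q' + int (edge_offset \<xi> (u', v))"
        if "q \<in> positions \<xi> a u" "q' \<in> positions \<xi> a u'" for q q'
      proof
        assume eq: "q + int (edge_offset \<xi> (u, v)) = q' + int (edge_offset \<xi> (u', v))"
        have "0 \<le> q" "q < int (num_paths u)" "0 \<le> q'" "q' < int (num_paths u')"
          using that positions_bounds by fastforce+
        moreover have "edge_offset \<xi> (u, v) + num_paths u \<le> edge_offset \<xi> (u', v)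
            \<or> edge_offset \<xi> (u', v) + num_paths u' \<le> edge_offset \<xi> (u, v)"
          by (rule edge_offset_disjoint) fact+
        ultimately show False using eq by linarith
      qed
      then show ?thesis by auto
    qed
    have "(\<Sum>u | (u, v) \<in> pascal_edges. card (positions \<xi> a u)) = (\<Sum>u | (u, v) \<in> pascal_edges. card (?Q u))"
      by (intro sum.cong refl card_image[symmetric]) (auto simp: inj_on_def)
    also have "\<dots> = card (\<Union>u\<in>{u. (u, v) \<in> pascal_edges}. ?Q u)"
      using dis by (intro card_UN_disjoint[symmetric]) auto
    also have "\<dots> \<le> card (positions \<xi> a v)"
      using positions_source[of _ v \<xi> a] by (intro card_mono) auto
    finally show "(\<Sum>u | (u, v) \<in> pascal_edges. real (card (positions \<xi> a u))) \<le> real (card (positions \<xi> a v))"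
      by (metis of_nat_le_iff of_nat_sum)
  qed
  then show ?case using Suc by (simp add: level_sum_sources)
qed

lemma frequency_0_pos: "frequency \<xi> a {0} > 0"
proof -
  have "1 / 2 ^ level a \<le> frequency \<xi> a {0}"
  proof (rule LIMSEQ_le_const[OF frequency_at_tendsto])
    show "\<exists>N. \<forall>n\<ge>N. 1 / 2 ^ level a \<le> frequency_at \<xi> a {0} n"
    proof (intro exI allI impI)
      fix N assume "level a \<le> N"
      then obtain n where "N = level a + n" using le_Suc_ex by blast
      then show "1 / 2 ^ level a \<le> frequency_at \<xi> a {0} N"
        using sum_card_positions_ge[of n \<xi> a]
        by (simp add: frequency_at_def spread_0 field_simps power_add)
    qed
  qed simp
  then show ?thesis by (smt (verit) divide_pos_pos zero_less_power)
qed

lemma linear_over_power_tendsto_0: "(\<lambda>N. (real N + 1) * c / 2 ^ N) \<longlonglongrightarrow> 0"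
proof -
  have "(\<lambda>N. (real N + 1) / 2 ^ N) \<longlonglongrightarrow> 0"
  proof -
    have "(\<lambda>N. real N * (1/2) ^ N + (1/2) ^ N) \<longlonglongrightarrow> 0 + 0"
      by (intro tendsto_add LIMSEQ_power_zero powser_times_n_limit_0) auto
    then show ?thesis by (simp add: power_divide add_divide_distrib)
  qed
  from tendsto_mult_right[OF this, of c] show ?thesis by (simp add: field_simps)
qed

text \<open>At \<open>v\<close> the set \<open>spread\<close> lies in an interval that exceeds the block of \<open>v\<close> by \<open>m\<close> on either
  side. The total excess on level \<open>N\<close> is linear in \<open>N\<close>, negligible against \<open>2 ^ N\<close>.\<close>

lemma frequency_interval_le_1:
  assumes "R \<subseteq> {- int m..int m}"
  shows "frequency \<xi> a R \<le> 1"
proof -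
  have fin: "finite R" using assms by (rule finite_subset) simp
  have "frequency \<xi> a R \<le> 1 + 0"
  proof (rule LIMSEQ_le[OF frequency_at_tendsto[OF fin] tendsto_add[OF tendsto_const linear_over_power_tendsto_0]])
    show "\<exists>N. \<forall>n\<ge>N. frequency_at \<xi> a R n \<le> 1 + (real n + 1) * (2 * real m) / 2 ^ n"
    proof (intro exI allI impI)
      fix n
      have "level_sum (\<lambda>v. real (card (spread \<xi> a R v))) n \<le> level_sum (\<lambda>v. real (num_paths v) + 2 * real m) n"
      proof (rule level_sum_mono)
        fix v
        have "spread \<xi> a R v \<subseteq> {- int m..<int (num_paths v) + int m}"
          using assms positions_bounds[of \<xi> a v] by (fastforce simp: spread_def)
        then have "card (spread \<xi> a R v) \<le> card {- int m..<int (num_paths v) + int m}"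
          by (intro card_mono) auto
        then show "real (card (spread \<xi> a R v)) \<le> real (num_paths v) + 2 * real m" by simp
      qed
      also have "\<dots> = 2 ^ n + (real n + 1) * (2 * real m)"
        by (simp add: level_sum_add level_sum_const level_sum_num_paths)
      finally show "frequency_at \<xi> a R n \<le> 1 + (real n + 1) * (2 * real m) / 2 ^ n"
        by (simp add: frequency_at_def field_simps)
    qed
  qed
  then show ?thesis by simp
qed

text \<open>Translates of the set of copies that meet nowhere would have additive frequencies. As a single
  translate has positive frequency, only finitely many can be disjoint.\<close>

lemma returns_syndetic:
  fixes f :: "nat \<Rightarrow> int"
  shows "\<exists>k l. k < l \<and> f l - f k \<in> returns \<xi> a"
proof (rule ccontr)
  assume none: "\<not> ?thesis"
  have dis: "spread \<xi> a {f k} v \<inter> spread \<xi> a {f l} v = {}" if "k < l" for k l v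
  proof (rule ccontr)
    assume "\<not> ?thesis"
    then obtain s t where st: "copy \<xi> a v s" "copy \<xi> a v t" "int s + f k = int t + f l"
      by (auto simp: spread_def positions_def)
    have "f l - f k = int s - int t" using st(3) by simp
    then show False using none that returnsI[OF st(2,1)] by metis
  qed
  have packed: "real n * frequency \<xi> a {0} \<le> frequency \<xi> a (f ` {..<n})" for n
  proof (induction n)
    case (Suc n)
    have "frequency \<xi> a {f n} = frequency \<xi> a {0}"
      using frequency_translate[of "{0}" \<xi> a "f n"] by (simp add: translate_def)
    moreover have "frequency \<xi> a (f ` {..<n}) + frequency \<xi> a {f n} \<le> frequency \<xi> a (f ` {..<n} \<union> {f n})"
    proof (rule frequency_disjoint)
      fix v
      have "spread \<xi> a (f ` {..<n}) v = (\<Union>k<n. spread \<xi> a {f k} v)" by (simp add: spread_def)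
      then show "spread \<xi> a (f ` {..<n}) v \<inter> spread \<xi> a {f n} v = {}" using dis by blast
    qed auto
    moreover have "f ` {..<n} \<union> {f n} = f ` {..<Suc n}" by (auto simp: lessThan_Suc)
    ultimately show ?case using Suc by (simp add: algebra_simps)
  qed (simp add: frequency_empty)
  obtain n :: nat where n: "1 < real n * frequency \<xi> a {0}"
    using reals_Archimedean3[OF frequency_0_pos] by blast
  define M where "M = (\<Sum>k<n. nat \<bar>f k\<bar>)"
  note n
  also have "real n * frequency \<xi> a {0} \<le> frequency \<xi> a (f ` {..<n})" by (rule packed)
  also have "\<dots> \<le> 1"
  proof (rule frequency_interval_le_1)
    show "f ` {..<n} \<subseteq> {- int M..int M}"
    proof (intro image_subsetI)
      fix k assume "k \<in> {..<n}"
      then have "nat \<bar>f k\<bar> \<le> M" unfolding M_def by (intro member_le_sum) auto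
      then show "f k \<in> {- int M..int M}" by auto
    qed
  qed
  finally show False by simp
qed

section \<open>Every integer is a difference of return times\<close>

text \<open>Let one point start at the beginning of the block of \<open>w\<close>, so that it enters copies of the block
  of \<open>a\<close> at the times \<open>q \<in> positions \<xi> a w\<close>. A second point enters a copy beginning at \<open>p\<close> at the time
  \<open>q\<close> iff it starts at \<open>p - q\<close>. So the starting points from which both enter a copy at the same time
  form the spread of the set of all \<open>- q\<close>.\<close>

definition reflected :: "(vertex \<Rightarrow> bool) \<Rightarrow> vertex \<Rightarrow> vertex \<Rightarrow> int set" where
  "reflected \<xi> a w = uminus ` positions \<xi> a w"

lemma finite_reflected [simp]: "finite (reflected \<xi> a w)"
  by (simp add: reflected_def)

lemma reflected_copy:
  assumes "copy \<xi> w v s"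
  shows "translate (- int s) (reflected \<xi> a w) \<subseteq> reflected \<xi> a v"
proof
  fix r assume "r \<in> translate (- int s) (reflected \<xi> a w)"
  then obtain p where p: "copy \<xi> a w p" "r = - int p + - int s"
    by (auto simp: reflected_def positions_def translate_def)
  then have "copy \<xi> a v (p + s)" using copy_trans assms by blast
  then have "int (p + s) \<in> positions \<xi> a v" unfolding positions_def by blast
  moreover have "r = - int (p + s)" using p(2) by simp
  ultimately show "r \<in> reflected \<xi> a v" unfolding reflected_def by (metis imageI)
qed

definition meet_frequency :: "(vertex \<Rightarrow> bool) \<Rightarrow> vertex \<Rightarrow> vertex \<Rightarrow> int \<Rightarrow> real" where
  "meet_frequency \<xi> a w t = frequency \<xi> a (reflected \<xi> a w \<union> translate t (reflected \<xi> a w))"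

lemma meet_frequency_0: "meet_frequency \<xi> a w 0 = frequency \<xi> a (reflected \<xi> a w)"
  by (simp add: meet_frequency_def)

lemma meet_frequency_0_le_1: "meet_frequency \<xi> a w 0 \<le> 1"
  unfolding meet_frequency_0
proof (rule frequency_interval_le_1)
  show "reflected \<xi> a w \<subseteq> {- int (num_paths w)..int (num_paths w)}"
    using positions_bounds[of \<xi> a w] by (auto simp: reflected_def)
qed

lemma meet_frequency_copy:
  assumes "copy \<xi> w v s"
  shows "meet_frequency \<xi> a w t \<le> meet_frequency \<xi> a v t"
proof -
  let ?R = "reflected \<xi> a w" and ?R' = "reflected \<xi> a v"
  have sub: "translate (- int s) ?R \<subseteq> ?R'" by (rule reflected_copy[OF assms])
  have "translate (- int s) (?R \<union> translate t ?R)
      = translate (- int s) ?R \<union> translate t (translate (- int s) ?R)"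
    by (simp add: translate_Un translate_translate add.commute)
  also have "\<dots> \<subseteq> ?R' \<union> translate t ?R'" by (intro Un_mono translate_mono sub)
  finally have "translate (- int s) (?R \<union> translate t ?R) \<subseteq> ?R' \<union> translate t ?R'" .
  then have "frequency \<xi> a (translate (- int s) (?R \<union> translate t ?R)) \<le> frequency \<xi> a (?R' \<union> translate t ?R')"
    by (intro frequency_mono) auto
  then show ?thesis by (simp add: meet_frequency_def frequency_translate)
qed

lemma meet_frequency_mono:
  "fst w \<le> fst v \<Longrightarrow> snd w \<le> snd v \<Longrightarrow> meet_frequency \<xi> a w t \<le> meet_frequency \<xi> a v t"
  using copy_exists meet_frequency_copy by metis

text \<open>If two copies of \<open>w\<close> at distance \<open>t\<close> lie in \<open>v\<close>, then up to a common translation both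
  \<open>reflected \<xi> a w\<close> and its translate by \<open>t\<close> are contained in \<open>reflected \<xi> a v\<close>. So the union of the
  two is subject to the same upper bound as every single reflected set.\<close>

lemma meet_frequency_return:
  assumes "t \<in> returns \<xi> w"
  shows "\<exists>v. meet_frequency \<xi> a w t \<le> meet_frequency \<xi> a v 0"
proof -
  obtain p q v where v: "copy \<xi> w v p" "copy \<xi> w v q" "t = int q - int p"
    using assms by (auto simp: returns_def)
  let ?R = "reflected \<xi> a w"
  have "translate (- int q) (?R \<union> translate t ?R) = translate (- int q) ?R \<union> translate (- int p) ?R"
    by (simp add: translate_Un translate_translate v(3))
  also have "\<dots> \<subseteq> reflected \<xi> a v" by (intro Un_least reflected_copy v)
  finally have "frequency \<xi> a (translate (- int q) (?R \<union> translate t ?R)) \<le> frequency \<xi> a (reflected \<xi> a v)"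
    by (intro frequency_mono) auto
  then show ?thesis
    by (intro exI[of _ v]) (simp add: meet_frequency_def frequency_translate)
qed

lemma meet_frequency_le_2: "meet_frequency \<xi> a w t \<le> 2"
proof -
  let ?R = "reflected \<xi> a w"
  have "meet_frequency \<xi> a w t + frequency \<xi> a {} \<le> frequency \<xi> a ?R + frequency \<xi> a (translate t ?R)"
    unfolding meet_frequency_def by (rule frequency_submodular) auto
  then show ?thesis
    using meet_frequency_0_le_1[of \<xi> a w]
    by (simp add: frequency_empty frequency_translate meet_frequency_0)
qed

text \<open>The diagonal vertices are cofinal, so a limit along them replaces the supremum over all vertices.\<close>

definition meet_limit :: "(vertex \<Rightarrow> bool) \<Rightarrow> vertex \<Rightarrow> int \<Rightarrow> real" where
  "meet_limit \<xi> a t = lim (\<lambda>n. meet_frequency \<xi> a (n, n) t)"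

lemma meet_limit: "(\<lambda>n. meet_frequency \<xi> a (n, n) t) \<longlonglongrightarrow> meet_limit \<xi> a t"
  and meet_limit_upper: "meet_frequency \<xi> a w t \<le> meet_limit \<xi> a t"
proof -
  have inc: "incseq (\<lambda>n. meet_frequency \<xi> a (n, n) t)"
    by (intro incseq_SucI meet_frequency_mono) auto
  then obtain L where "(\<lambda>n. meet_frequency \<xi> a (n, n) t) \<longlonglongrightarrow> L"
    using incseq_convergent[of _ 2] meet_frequency_le_2 by metis
  then show lim: "(\<lambda>n. meet_frequency \<xi> a (n, n) t) \<longlonglongrightarrow> meet_limit \<xi> a t"
    by (simp add: meet_limit_def limI)
  let ?n = "max (fst w) (snd w)"
  have "meet_frequency \<xi> a w t \<le> meet_frequency \<xi> a (?n, ?n) t" by (rule meet_frequency_mono) auto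
  also have "\<dots> \<le> meet_limit \<xi> a t" by (rule incseq_le[OF inc lim])
  finally show "meet_frequency \<xi> a w t \<le> meet_limit \<xi> a t" .
qed

text \<open>The limiting frequency of what a translation by \<open>t\<close> adds to the reflected set.\<close>

definition defect :: "(vertex \<Rightarrow> bool) \<Rightarrow> vertex \<Rightarrow> int \<Rightarrow> real" where
  "defect \<xi> a t = meet_limit \<xi> a t - meet_limit \<xi> a 0"

text \<open>Symmetry is translation invariance of the frequency; the triangle inequality is its
  submodularity, applied to two unions that share the translate by \<open>t\<close>.\<close>

lemma defect_seminorm: "int_seminorm (defect \<xi> a)"
proof
  show "defect \<xi> a 0 = 0" by (simp add: defect_def)
next
  fix t
  have "meet_frequency \<xi> a w (- t) = meet_frequency \<xi> a w t" for w
  proof -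
    let ?R = "reflected \<xi> a w"
    have "frequency \<xi> a (?R \<union> translate (- t) ?R) = frequency \<xi> a (translate t (?R \<union> translate (- t) ?R))"
      by (simp add: frequency_translate)
    also have "translate t (?R \<union> translate (- t) ?R) = ?R \<union> translate t ?R"
      by (auto simp: translate_Un translate_translate)
    finally show ?thesis by (simp add: meet_frequency_def)
  qed
  then show "defect \<xi> a (- t) = defect \<xi> a t" by (simp add: defect_def meet_limit_def)
next
  fix s t
  have "meet_limit \<xi> a (s + t) + meet_limit \<xi> a 0 \<le> meet_limit \<xi> a t + meet_limit \<xi> a s"
  proof (rule LIMSEQ_le[OF tendsto_add[OF meet_limit meet_limit] tendsto_add[OF meet_limit meet_limit]])
    show "\<exists>N. \<forall>n\<ge>N. meet_frequency \<xi> a (n, n) (s + t) + meet_frequency \<xi> a (n, n) 0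
        \<le> meet_frequency \<xi> a (n, n) t + meet_frequency \<xi> a (n, n) s"
    proof (intro exI allI impI)
      fix n
      let ?R = "reflected \<xi> a (n, n)" and ?f = "frequency \<xi> a"
      have tr: "translate t (?R \<union> translate s ?R) = translate t ?R \<union> translate (s + t) ?R"
        by (simp only: translate_Un translate_translate)
      have "?f ((?R \<union> translate t ?R) \<union> translate t (?R \<union> translate s ?R)) + ?f (translate t ?R)
          \<le> ?f (?R \<union> translate t ?R) + ?f (translate t (?R \<union> translate s ?R))"
        by (rule frequency_submodular) (auto simp: translate_Un)
      moreover have "?f (?R \<union> translate (s + t) ?R) \<le> ?f ((?R \<union> translate t ?R) \<union> translate t (?R \<union> translate s ?R))"
        unfolding tr by (rule frequency_mono) auto
      ultimately show "meet_frequency \<xi> a (n, n) (s + t) + meet_frequency \<xi> a (n, n) 0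
        \<le> meet_frequency \<xi> a (n, n) t + meet_frequency \<xi> a (n, n) s"
        by (simp add: meet_frequency_def frequency_translate)
    qed
  qed
  then show "defect \<xi> a (s + t) \<le> defect \<xi> a s + defect \<xi> a t" by (simp add: defect_def)
qed

text \<open>Choose \<open>m\<close> such that the frequency for \<open>(m, m)\<close> is within \<open>\<epsilon> / 2\<close> of its supremum \<open>c\<close>. For a
  return time \<open>t\<close> of \<open>(m, m)\<close> the set of \<open>(m, m)\<close> and its translate by \<open>t\<close> together have frequency at most \<open>c\<close>,
  and a larger set of some \<open>(n, n)\<close> and its translate add at most \<open>\<epsilon> / 2\<close> each.\<close>

lemma defect_return_small:
  assumes "\<epsilon> > 0"
  shows "\<exists>n. \<forall>t\<in>returns \<xi> (n, n). defect \<xi> a t \<le> \<epsilon>"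
proof -
  define c where "c = meet_limit \<xi> a 0"
  have "\<forall>\<^sub>F n in sequentially. c - \<epsilon> / 2 < meet_frequency \<xi> a (n, n) 0"
    by (rule order_tendstoD(1)[OF meet_limit]) (use assms in \<open>simp add: c_def\<close>)
  then obtain m where m: "c - \<epsilon> / 2 < meet_frequency \<xi> a (m, m) 0"
    unfolding eventually_sequentially by blast
  have "defect \<xi> a t \<le> \<epsilon>" if t: "t \<in> returns \<xi> (m, m)" for t
  proof -
    have "meet_limit \<xi> a t \<le> c + \<epsilon>"
    proof (rule LIMSEQ_le_const2[OF meet_limit])
      show "\<exists>N. \<forall>n\<ge>N. meet_frequency \<xi> a (n, n) t \<le> c + \<epsilon>"
      proof (intro exI allI impI)
        fix n assume "m \<le> n"
        then obtain s where s: "copy \<xi> (m, m) (n, n) s" using copy_exists[of "(m, m)" "(n, n)"] by auto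
        let ?f = "frequency \<xi> a" and ?R = "reflected \<xi> a (n, n)" and ?M = "reflected \<xi> a (m, m)"
        define Q where "Q = translate (- int s) ?M"
        have Q: "Q \<subseteq> ?R" "finite Q" unfolding Q_def using reflected_copy[OF s] by auto
        have fQ: "?f Q = meet_frequency \<xi> a (m, m) 0"
          by (simp add: Q_def frequency_translate meet_frequency_0)
        have "Q \<union> translate t Q = translate (- int s) (?M \<union> translate t ?M)"
          unfolding Q_def by (simp add: translate_Un translate_translate add.commute)
        then have "?f (Q \<union> translate t Q) = meet_frequency \<xi> a (m, m) t"
          by (simp add: frequency_translate meet_frequency_def)
        also obtain v where "meet_frequency \<xi> a (m, m) t \<le> meet_frequency \<xi> a v 0"
          using meet_frequency_return[OF t] by blast
        also have "\<dots> \<le> c" unfolding c_def by (rule meet_limit_upper)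
        finally have QQ: "?f (Q \<union> translate t Q) \<le> c" .
        have "?f (?R \<union> (Q \<union> translate t Q)) + ?f Q \<le> ?f ?R + ?f (Q \<union> translate t Q)"
          by (rule frequency_submodular) (use Q in auto)
        moreover have "?f ((?R \<union> (Q \<union> translate t Q)) \<union> translate t ?R) + ?f (translate t Q)
            \<le> ?f (?R \<union> (Q \<union> translate t Q)) + ?f (translate t ?R)"
          by (rule frequency_submodular) (use Q translate_mono[OF Q(1), of t] in auto)
        moreover have "?f (?R \<union> translate t ?R) \<le> ?f ((?R \<union> (Q \<union> translate t Q)) \<union> translate t ?R)"
          by (rule frequency_mono) (use Q in auto)
        moreover have "?f ?R \<le> c"
          using meet_limit_upper[of \<xi> a "(n, n)" 0] by (simp add: meet_frequency_0 c_def)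
        ultimately show "meet_frequency \<xi> a (n, n) t \<le> c + \<epsilon>"
          using fQ QQ m Q(2) by (simp add: frequency_translate meet_frequency_def)
      qed
    qed
    then show ?thesis by (simp add: defect_def c_def)
  qed
  then show ?thesis by blast
qed

text \<open>Small defects at return times make the defect precompact, because return times are syndetic,
  and small at the return times around unit squares. No seminorm except \<open>0\<close> has both properties.\<close>

lemma defect_vanishes: "defect \<xi> a t = 0"
proof -
  interpret int_seminorm "defect \<xi> a" by (rule defect_seminorm)
  have "defect \<xi> a 1 = 0"
  proof (rule vanishes_at_1)
    fix f :: "nat \<Rightarrow> int" and \<eta> :: real assume "\<eta> > 0"
    then obtain n where "\<forall>t\<in>returns \<xi> (n, n). defect \<xi> a t \<le> \<eta>" using defect_return_small by blast
    then show "\<exists>k l. k < l \<and> defect \<xi> a (f l - f k) \<le> \<eta>" using returns_syndetic by blast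
  next
    fix \<epsilon> :: real assume "\<epsilon> > 0"
    then obtain n where n: "\<forall>t\<in>returns \<xi> (n, n). defect \<xi> a t \<le> \<epsilon>" using defect_return_small by blast
    have "\<exists>e1\<in>{0, 1}. \<exists>e2\<in>{0, 1}. defect \<xi> a (int ((x + y) choose y) + e1 * int ((x + y) choose (y - 1))
            + e2 * int ((x + y) choose (y + 1))) \<le> \<epsilon>" if "Suc n \<le> x" "Suc n \<le> y" for x y
    proof -
      obtain x' y' where xy: "x = Suc x'" "y = Suc y'" using \<open>Suc n \<le> x\<close> \<open>Suc n \<le> y\<close> Suc_le_D by metis
      have "num_paths (Suc x', Suc y') = (x + y) choose y"
        "num_paths (Suc (Suc x'), y') = (x + y) choose (y - 1)"
        "num_paths (x', Suc (Suc y')) = (x + y) choose (y + 1)"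
        by (simp_all add: xy num_paths_def)
      then show ?thesis
        using square_return[of "(n, n)" x' y' \<xi>] n \<open>Suc n \<le> x\<close> \<open>Suc n \<le> y\<close> xy by fastforce
    qed
    then show "\<exists>n. \<forall>x\<ge>n. \<forall>y\<ge>n. \<exists>e1\<in>{0, 1}. \<exists>e2\<in>{0, 1}.
        defect \<xi> a (int ((x + y) choose y) + e1 * int ((x + y) choose (y - 1))
            + e2 * int ((x + y) choose (y + 1))) \<le> \<epsilon>" by blast
  qed
  then show ?thesis by (rule vanishes)
qed

text \<open>If \<open>d\<close> were not a difference of two return times, then for a copy at \<open>q\<close> in \<open>(n, n)\<close> the
  translate by \<open>d - q\<close> of the set of copies would miss the spread of the reflected set altogether while
  being part of its translate by \<open>d\<close>. The defect of \<open>d\<close> would be at least the frequency of the copies.\<close>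

lemma returns_differences:
  "\<exists>s\<in>returns \<xi> a. \<exists>t\<in>returns \<xi> a. s - t = d"
proof (rule ccontr)
  assume none: "\<not> ?thesis"
  have "frequency \<xi> a {0} \<le> defect \<xi> a d"
  proof -
    have "meet_limit \<xi> a 0 + frequency \<xi> a {0} \<le> meet_limit \<xi> a d"
    proof (rule LIMSEQ_le[OF tendsto_add[OF meet_limit tendsto_const] meet_limit])
      show "\<exists>N. \<forall>n\<ge>N. meet_frequency \<xi> a (n, n) 0 + frequency \<xi> a {0} \<le> meet_frequency \<xi> a (n, n) d"
      proof (intro exI allI impI)
        fix n assume "max (fst a) (snd a) \<le> n"
        then obtain q where q: "copy \<xi> a (n, n) q" using copy_exists[of a "(n, n)"] by auto
        let ?R = "reflected \<xi> a (n, n)"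
        have qR: "- int q \<in> ?R" using q by (auto simp: reflected_def positions_def)
        have "frequency \<xi> a ?R + frequency \<xi> a {d - int q} \<le> frequency \<xi> a (?R \<union> {d - int q})"
        proof (rule frequency_disjoint)
          fix v
          show "spread \<xi> a ?R v \<inter> spread \<xi> a {d - int q} v = {}"
          proof (rule ccontr)
            assume "\<not> ?thesis"
            then obtain x where x: "x \<in> spread \<xi> a ?R v" "x \<in> spread \<xi> a {d - int q} v" by blast
            obtain r p where rp: "copy \<xi> a v r" "copy \<xi> a (n, n) p" "x = int r - int p"
              using x(1) by (auto simp: spread_def reflected_def positions_def)
            obtain s where s: "copy \<xi> a v s" "x = int s + (d - int q)"
              using x(2) by (auto simp: spread_def positions_def)
            have "int r - int s \<in> returns \<xi> a" "int p - int q \<in> returns \<xi> a"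
              using q rp s by (auto intro: returnsI)
            moreover have "(int r - int s) - (int p - int q) = d" using rp(3) s(2) by simp
            ultimately show False using none by blast
          qed
        qed auto
        also have "frequency \<xi> a {d - int q} = frequency \<xi> a {0}"
          using frequency_translate[of "{0}" \<xi> a "d - int q"] by (simp add: translate_def)
        also have "frequency \<xi> a (?R \<union> {d - int q}) \<le> frequency \<xi> a (?R \<union> translate d ?R)"
          using qR by (intro frequency_mono) (auto simp: translate_def intro: image_eqI[of _ _ "- int q"])
        finally show "meet_frequency \<xi> a (n, n) 0 + frequency \<xi> a {0} \<le> meet_frequency \<xi> a (n, n) d"
          by (simp add: meet_frequency_def)
      qed
    qed
    then show ?thesis by (simp add: defect_def)
  qed
  with frequency_0_pos[of \<xi> a] show False by (simp add: defect_vanishes)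
qed

lemma returns_unbounded: "\<exists>r\<in>returns \<xi> a. b \<le> r"
proof -
  define x where "x = max (nat b) (max (fst a) (snd a))"
  have "fst a \<le> Suc x" "snd a \<le> Suc x" by (simp_all add: x_def)
  from square_return[OF this, of \<xi>] obtain e1 e2 :: int where e: "e1 \<in> {0, 1}" "e2 \<in> {0, 1}"
    "int (num_paths (Suc x, Suc x)) + e1 * int (num_paths (Suc (Suc x), x))
      + e2 * int (num_paths (x, Suc (Suc x))) \<in> returns \<xi> a" (is "?r \<in> _")
    by blast
  obtain s where "copy \<xi> (x, Suc 0) (Suc x, Suc x) s"
    using copy_exists[of "(x, Suc 0)" "(Suc x, Suc x)" \<xi>] by auto
  from copy_bound[OF this] have "num_paths (x, Suc 0) \<le> num_paths (Suc x, Suc x)" by linarith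
  moreover have "num_paths (x, Suc 0) = Suc x" by (simp add: num_paths_def)
  moreover have "0 \<le> e1 * int (num_paths (Suc (Suc x), x))" "0 \<le> e2 * int (num_paths (x, Suc (Suc x)))"
    using e(1,2) by (auto intro: mult_nonneg_nonneg)
  moreover have "b \<le> int x" by (auto simp: x_def)
  ultimately have "b \<le> ?r" by linarith
  with e(3) show ?thesis by blast
qed

text \<open>Adding to both return times a common large return time of a vertex beyond both blocks in which
  they occur leaves their difference unchanged. Large return times are needed because transitivity
  only allows forward iterates.\<close>

lemma returns_large_differences:
  "\<exists>s\<in>returns \<xi> a. \<exists>t\<in>returns \<xi> a. s - t = d \<and> b \<le> s"
proof -
  obtain s t where st: "s \<in> returns \<xi> a" "t \<in> returns \<xi> a" "s - t = d"
    using returns_differences by blast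
  obtain v p q where v: "copy \<xi> a v p" "copy \<xi> a v q" "s = int q - int p"
    using st(1) by (auto simp: returns_def)
  obtain w p' q' where w: "copy \<xi> a w p'" "copy \<xi> a w q'" "t = int q' - int p'"
    using st(2) by (auto simp: returns_def)
  obtain r where r: "r \<in> returns \<xi> (max (fst v) (fst w), max (snd v) (snd w))" "b - s \<le> r"
    using returns_unbounded by blast
  then have "r \<in> returns \<xi> v" "r \<in> returns \<xi> w"
    using returns_antimono[of v "(max (fst v) (fst w), max (snd v) (snd w))" \<xi>]
      returns_antimono[of w "(max (fst v) (fst w), max (snd v) (snd w))" \<xi>] by auto
  then have "s + r \<in> returns \<xi> a" "t + r \<in> returns \<xi> a"
    unfolding v(3) w(3) using returns_add v(1,2) w(1,2) by blast+
  then show ?thesis using st(3) r(2) by (intro bexI[of _ "s + r"] bexI[of _ "t + r"]) auto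
qed

section \<open>The adic map in terms of positions\<close>

definition vertex :: "path \<Rightarrow> nat \<Rightarrow> vertex" where
  "vertex \<gamma> N = fst (\<gamma> N)"

text \<open>The rank of the initial segment of length \<open>N\<close> among all finite paths with the same end vertex.
  Positions turn the order on paths, the adic map and its powers into arithmetic.\<close>

definition position :: "(vertex \<Rightarrow> bool) \<Rightarrow> path \<Rightarrow> nat \<Rightarrow> nat" where
  "position \<xi> \<gamma> N = (\<Sum>i<N. edge_offset \<xi> (\<gamma> i))"

lemma position_0 [simp]: "position \<xi> \<gamma> 0 = 0"
  and position_Suc: "position \<xi> \<gamma> (Suc N) = position \<xi> \<gamma> N + edge_offset \<xi> (\<gamma> N)"
  by (simp_all add: position_def)

lemma paths_vertex_0: "\<gamma> \<in> paths \<Longrightarrow> vertex \<gamma> 0 = (0, 0)"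
  by (simp add: paths_def vertex_def)

lemma paths_edge_eq: "\<gamma> \<in> paths \<Longrightarrow> \<gamma> N = (vertex \<gamma> N, vertex \<gamma> (Suc N))"
  by (simp add: paths_def vertex_def)

lemma paths_edge: "\<gamma> \<in> paths \<Longrightarrow> (vertex \<gamma> N, vertex \<gamma> (Suc N)) \<in> pascal_edges"
  unfolding paths_edge_eq[of \<gamma> N, symmetric] by (simp add: paths_def)

lemma level_vertex: "\<gamma> \<in> paths \<Longrightarrow> level (vertex \<gamma> N) = N"
  by (induction N) (simp_all add: paths_vertex_0 level_edge[OF paths_edge] level_def[of "(0, 0)"])

lemma position_less: "\<gamma> \<in> paths \<Longrightarrow> position \<xi> \<gamma> N < num_paths (vertex \<gamma> N)"
proof (induction N)
  case (Suc N)
  then show ?case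
    using edge_offset_bound[OF paths_edge[OF Suc.prems], of \<xi> N] paths_edge_eq[OF Suc.prems, of N]
    by (simp add: position_Suc)
qed (simp add: num_paths_pos)

lemma position_Suc_range:
  assumes "\<gamma> \<in> paths"
  shows "edge_offset \<xi> (vertex \<gamma> N, vertex \<gamma> (Suc N)) \<le> position \<xi> \<gamma> (Suc N)"
    and "position \<xi> \<gamma> (Suc N) < edge_offset \<xi> (vertex \<gamma> N, vertex \<gamma> (Suc N)) + num_paths (vertex \<gamma> N)"
  using position_less[OF assms, of \<xi> N] paths_edge_eq[OF assms, of N] by (simp_all add: position_Suc)

text \<open>Walking backwards from the common vertex, the position determines each last edge, since the
  positions belonging to the two entering edges form disjoint intervals.\<close>

lemma same_position_imp_same_prefix:
  assumes "\<gamma> \<in> paths" "\<eta> \<in> paths" "vertex \<gamma> N = vertex \<eta> N" "position \<xi> \<gamma> N = position \<xi> \<eta> N"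
  shows "\<forall>i<N. \<gamma> i = \<eta> i"
  using assms(3,4)
proof (induction N)
  case (Suc N)
  have same: "vertex \<gamma> N = vertex \<eta> N"
  proof (rule ccontr)
    assume "vertex \<gamma> N \<noteq> vertex \<eta> N"
    from edge_offset_disjoint[OF _ _ this, of "vertex \<gamma> (Suc N)" \<xi>] show False
      using paths_edge[OF assms(1), of N] paths_edge[OF assms(2), of N] Suc.prems
        position_Suc_range[OF assms(1), of \<xi> N] position_Suc_range[OF assms(2), of \<xi> N]
      by (simp; linarith)
  qed
  then have "\<gamma> N = \<eta> N" using paths_edge_eq assms(1,2) Suc.prems(1) by metis
  moreover from this have "position \<xi> \<gamma> N = position \<xi> \<eta> N"
    using Suc.prems(2) by (simp add: position_Suc)
  ultimately show ?case using Suc.IH[OF same] by (metis less_Suc_eq)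
qed simp

lemma paths_splice:
  assumes "\<gamma> \<in> paths" "\<eta> \<in> paths" "vertex \<gamma> N = vertex \<eta> N"
  shows "(\<lambda>m. if m < N then \<gamma> m else \<eta> m) \<in> paths"
proof -
  have "fst (if Suc i < N then \<gamma> (Suc i) else \<eta> (Suc i)) = snd (if i < N then \<gamma> i else \<eta> i)" for i
  proof (cases "Suc i = N")
    case True
    then show ?thesis using assms(1,3) by (auto simp: paths_def vertex_def)
  qed (use assms in \<open>auto simp: paths_def\<close>)
  moreover have "fst (if 0 < N then \<gamma> 0 else \<eta> 0) = (0, 0)" using assms by (simp add: paths_def)
  ultimately show ?thesis using assms(1,2) unfolding paths_def by simp
qed

lemma path_extend:
  assumes "\<gamma> \<in> paths" "(vertex \<gamma> N, v) \<in> pascal_edges"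
  shows "\<exists>\<eta>\<in>paths. (\<forall>m<N. \<eta> m = \<gamma> m) \<and> vertex \<eta> N = vertex \<gamma> N \<and> vertex \<eta> (Suc N) = v"
proof -
  define \<eta> where "\<eta> m = (if m < N then \<gamma> m else if m = N then (vertex \<gamma> N, v)
      else ((fst v + (m - Suc N), snd v), (fst v + (m - N), snd v)))" for m
  have "\<eta> \<in> paths" unfolding paths_def
  proof (intro CollectI conjI allI)
    show "fst (\<eta> 0) = (0, 0)"
      using paths_vertex_0[OF assms(1)] by (cases N) (auto simp: \<eta>_def vertex_def)
    fix i
    show "\<eta> i \<in> pascal_edges"
      using assms by (auto simp: \<eta>_def paths_def pascal_edges_iff)
    have "fst (\<gamma> (Suc i)) = snd (\<gamma> i)" using assms(1) by (simp add: paths_def)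
    then show "fst (\<eta> (Suc i)) = snd (\<eta> i)"
      by (cases "Suc i = N") (auto simp: \<eta>_def vertex_def)
  qed
  then show ?thesis by (intro bexI[of _ \<eta>]) (auto simp: \<eta>_def vertex_def)
qed

lemma source_of_position:
  assumes "v \<noteq> (0, 0)" "i < num_paths v"
  shows "\<exists>u. (u, v) \<in> pascal_edges \<and> edge_offset \<xi> (u, v) \<le> i \<and> i < edge_offset \<xi> (u, v) + num_paths u"
proof -
  obtain x y where v: "v = (x, y)" by fastforce
  show ?thesis
  proof (cases "x = 0 \<or> y = 0")
    case True
    obtain u where u: "(u, v) \<in> pascal_edges"
    proof
      show "((if x = 0 then (0, y - 1) else (x - 1, 0)), v) \<in> pascal_edges"
        using True assms(1) by (auto simp: v pascal_edges_iff)
    qed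
    from u have "edge_offset \<xi> (u, v) = 0"
      unfolding v using True by (rule edge_offset_boundary(1))
    moreover from u have "num_paths u = num_paths v"
      unfolding v using True by (rule edge_offset_boundary(2))
    ultimately show ?thesis using assms(2) u by (intro exI[of _ u]) simp
  next
    case False
    then obtain x' y' where v': "v = (Suc x', Suc y')" unfolding v by (cases x; cases y) auto
    obtain u1 u2 where u: "{u. (u, v) \<in> pascal_edges} = {u1, u2}"
      "edge_offset \<xi> (u1, v) = 0" "edge_offset \<xi> (u2, v) = num_paths u1"
      "num_paths v = num_paths u1 + num_paths u2"
      using interior_sources[of x' y' \<xi>] v' by metis
    then have E: "(u1, v) \<in> pascal_edges" "(u2, v) \<in> pascal_edges" by blast+
    show ?thesis
    proof (cases "i < num_paths u1")
      case True
      then show ?thesis using u E by (intro exI[of _ u1]) simp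
    next
      case False
      then show ?thesis using u E assms(2) by (intro exI[of _ u2]) simp
    qed
  qed
qed

lemma path_exists:
  assumes "i < num_paths v"
  shows "\<exists>\<gamma>\<in>paths. vertex \<gamma> (level v) = v \<and> position \<xi> \<gamma> (level v) = i"
  using assms
proof (induction "level v" arbitrary: v i)
  case 0
  then have v: "v = (0, 0)" by (cases v) (simp add: level_def)
  have "(\<lambda>m. ((m, 0), (Suc m, 0))) \<in> paths" by (simp add: paths_def pascal_edges_iff)
  with 0 show ?case unfolding v by (intro bexI) (auto simp: vertex_def level_def)
next
  case (Suc N)
  then have "v \<noteq> (0, 0)" by (auto simp: level_def)
  from source_of_position[OF this Suc.prems, of \<xi>]
  obtain u where u: "(u, v) \<in> pascal_edges" "edge_offset \<xi> (u, v) \<le> i"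
    "i < edge_offset \<xi> (u, v) + num_paths u" by blast
  then have N: "level u = N" using level_edge[OF u(1)] Suc.hyps(2) by simp
  obtain \<gamma> where \<gamma>: "\<gamma> \<in> paths" "vertex \<gamma> N = u" "position \<xi> \<gamma> N = i - edge_offset \<xi> (u, v)"
    using Suc.hyps(1)[of u "i - edge_offset \<xi> (u, v)"] N u(2,3) by (auto simp: less_diff_conv2)
  obtain \<eta> where \<eta>: "\<eta> \<in> paths" "\<forall>m<N. \<eta> m = \<gamma> m" "vertex \<eta> N = u" "vertex \<eta> (Suc N) = v"
    using path_extend[of \<gamma> N v] \<gamma> u(1) by auto
  have "position \<xi> \<eta> N = position \<xi> \<gamma> N" using \<eta>(2) by (simp add: position_def)
  then have "position \<xi> \<eta> (Suc N) = i"
    using \<gamma>(3) u(2) \<eta>(3,4) paths_edge_eq[OF \<eta>(1), of N] by (simp add: position_Suc)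
  with \<eta> Suc.hyps(2) show ?case by (intro bexI[of _ \<eta>]) auto
qed

lemma reposition:
  assumes "\<gamma> \<in> paths" "i < num_paths (vertex \<gamma> N)"
  shows "\<exists>\<eta>\<in>paths. (\<forall>m\<ge>N. \<gamma> m = \<eta> m) \<and> position \<xi> \<eta> N = i"
proof -
  obtain \<zeta> where \<zeta>: "\<zeta> \<in> paths" "vertex \<zeta> N = vertex \<gamma> N" "position \<xi> \<zeta> N = i"
    using path_exists[OF assms(2)] level_vertex[OF assms(1)] by metis
  let ?\<eta> = "\<lambda>m. if m < N then \<zeta> m else \<gamma> m"
  have "?\<eta> \<in> paths" by (rule paths_splice) (use \<zeta> assms in auto)
  moreover have "position \<xi> ?\<eta> N = i" using \<zeta>(3) by (simp add: position_def)
  ultimately show ?thesis by (intro bexI[of _ ?\<eta>]) auto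
qed

lemma position_diff:
  assumes "\<forall>m\<ge>N. \<gamma> m = \<eta> m" "N \<le> M"
  shows "int (position \<xi> \<eta> M) - int (position \<xi> \<gamma> M) = int (position \<xi> \<eta> N) - int (position \<xi> \<gamma> N)"
  using assms(2) by (induction M rule: dec_induct) (use assms(1) in \<open>auto simp: position_Suc\<close>)

lemma edge_less_imp:
  assumes "edge_less \<xi> e f"
  shows "\<exists>u u' v. e = (u, v) \<and> f = (u', v) \<and> e \<in> pascal_edges \<and> f \<in> pascal_edges \<and> u \<noteq> u'
    \<and> edge_offset \<xi> e = 0 \<and> edge_offset \<xi> f = num_paths u \<and> num_paths v = num_paths u + num_paths u'"
proof -
  obtain x y where "if \<xi> (Suc x, Suc y)
      then e = ((x, Suc y), (Suc x, Suc y)) \<and> f = ((Suc x, y), (Suc x, Suc y))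
      else e = ((Suc x, y), (Suc x, Suc y)) \<and> f = ((x, Suc y), (Suc x, Suc y))"
    using assms unfolding edge_less_def Let_def Suc_eq_plus1 by blast
  then show ?thesis by (auto split: if_splits simp: pascal_edges_iff)
qed

lemma edge_less_total:
  assumes "(u, v) \<in> pascal_edges" "(u', v) \<in> pascal_edges" "u \<noteq> u'"
  shows "edge_less \<xi> (u, v) (u', v) \<or> edge_less \<xi> (u', v) (u, v)"
proof -
  obtain a b c d x y where uv: "u = (a, b)" "u' = (c, d)" "v = (x, y)" by fastforce
  then have "x \<noteq> 0" "y \<noteq> 0" using assms by (auto simp: pascal_edges_iff)
  then obtain x' y' where v': "v = (Suc x', Suc y')" unfolding uv by (cases x; cases y) auto
  obtain u1 u2 where "{u. (u, v) \<in> pascal_edges} = {u1, u2}" "edge_less \<xi> (u1, v) (u2, v)"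
    using interior_sources[of x' y' \<xi>] v' by metis
  moreover from this assms have "u \<in> {u1, u2}" "u' \<in> {u1, u2}" by blast+
  ultimately show ?thesis using assms(3) by auto
qed

lemma maximal_edge_iff:
  assumes "(u, v) \<in> pascal_edges"
  shows "maximal_edge \<xi> (u, v) \<longleftrightarrow> edge_offset \<xi> (u, v) + num_paths u = num_paths v"
proof
  assume max: "maximal_edge \<xi> (u, v)"
  show "edge_offset \<xi> (u, v) + num_paths u = num_paths v"
  proof (rule ccontr)
    assume ne: "\<not> ?thesis"
    obtain x y where v: "v = (x, y)" by fastforce
    have "\<not> (x = 0 \<or> y = 0)"
      using ne edge_offset_boundary[OF assms[unfolded v]] unfolding v by (metis add_0)
    then obtain x' y' where v': "v = (Suc x', Suc y')" unfolding v by (cases x; cases y) auto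
    obtain u1 u2 where u: "{u. (u, v) \<in> pascal_edges} = {u1, u2}" 
      "edge_offset \<xi> (u2, v) = num_paths u1"
      "num_paths v = num_paths u1 + num_paths u2" "edge_less \<xi> (u1, v) (u2, v)"
      using interior_sources[of x' y' \<xi>] v' by metis
    then have "u \<in> {u1, u2}" using assms by blast
    then have "u = u1" using u ne by auto
    moreover have "(u2, v) \<in> pascal_edges" using u(1) by blast
    ultimately show False using max u(4) by (auto simp: maximal_edge_def)
  qed
next
  assume eq: "edge_offset \<xi> (u, v) + num_paths u = num_paths v"
  show "maximal_edge \<xi> (u, v)"
    unfolding maximal_edge_def
  proof
    assume "\<exists>f\<in>pascal_edges. edge_less \<xi> (u, v) f"
    then obtain u' where "edge_offset \<xi> (u, v) = 0" "num_paths v = num_paths u + num_paths u'"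
      using edge_less_imp by (metis Pair_inject)
    with eq num_paths_pos[of u'] show False by simp
  qed
qed

lemma minimal_edge_iff:
  assumes "(u, v) \<in> pascal_edges"
  shows "minimal_edge \<xi> (u, v) \<longleftrightarrow> edge_offset \<xi> (u, v) = 0"
proof
  assume min: "minimal_edge \<xi> (u, v)"
  show "edge_offset \<xi> (u, v) = 0"
  proof (rule ccontr)
    assume ne: "\<not> ?thesis"
    obtain x y where v: "v = (x, y)" by fastforce
    have "\<not> (x = 0 \<or> y = 0)"
      using ne edge_offset_boundary[OF assms[unfolded v]] unfolding v by (metis add_0)
    then obtain x' y' where v': "v = (Suc x', Suc y')" unfolding v by (cases x; cases y) auto
    obtain u1 u2 where u: "{u. (u, v) \<in> pascal_edges} = {u1, u2}"
      "edge_offset \<xi> (u1, v) = 0" "edge_less \<xi> (u1, v) (u2, v)"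
      using interior_sources[of x' y' \<xi>] v' by metis
    then have "u \<in> {u1, u2}" using assms by blast
    then have "u = u2" using u(2) ne by auto
    moreover have "(u1, v) \<in> pascal_edges" using u(1) by blast
    ultimately show False using min u(3) by (auto simp: minimal_edge_def)
  qed
next
  assume eq: "edge_offset \<xi> (u, v) = 0"
  show "minimal_edge \<xi> (u, v)"
    unfolding minimal_edge_def
  proof
    assume "\<exists>f\<in>pascal_edges. edge_less \<xi> f (u, v)"
    then obtain u' where "edge_offset \<xi> (u, v) = num_paths u'"
      using edge_less_imp by metis
    with eq num_paths_pos[of u'] show False by simp
  qed
qed

lemma path_less_imp_position_less:
  assumes "path_less \<xi> \<gamma> \<eta>" "\<gamma> \<in> paths" "\<eta> \<in> paths"
  shows "\<exists>N. (\<forall>m\<ge>N. \<gamma> m = \<eta> m) \<and> position \<xi> \<gamma> N < position \<xi> \<eta> N"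
proof -
  obtain n where n: "\<forall>m>n. \<gamma> m = \<eta> m" "edge_less \<xi> (\<gamma> n) (\<eta> n)"
    using assms(1) by (auto simp: path_less_def)
  have off: "edge_offset \<xi> (\<gamma> n) = 0" "edge_offset \<xi> (\<eta> n) = num_paths (vertex \<gamma> n)"
    using edge_less_imp[OF n(2)] by (auto simp: vertex_def)
  have "position \<xi> \<gamma> (Suc n) < position \<xi> \<eta> (Suc n)"
    using position_less[OF assms(2), of \<xi> n] off by (simp add: position_Suc)
  with n(1) show ?thesis by (intro exI[of _ "Suc n"]) auto
qed

text \<open>At the last edge where the two paths differ they have a common target, and the smaller edge has
  offset \<open>0\<close> while the offset of the larger one counts all paths to the source of the smaller one. The
  later edges, being equal, contribute equally to both positions.\<close>

lemma path_less_iff: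
  assumes paths: "\<gamma> \<in> paths" "\<eta> \<in> paths" and N: "\<forall>m\<ge>N. \<gamma> m = \<eta> m"
  shows "path_less \<xi> \<gamma> \<eta> \<longleftrightarrow> position \<xi> \<gamma> N < position \<xi> \<eta> N"
proof -
  have imp: "position \<xi> \<gamma> N < position \<xi> \<eta> N"
    if less: "path_less \<xi> \<gamma> \<eta>" and \<gamma>\<eta>: "\<gamma> \<in> paths" "\<eta> \<in> paths" "\<forall>m\<ge>N. \<gamma> m = \<eta> m" for \<gamma> \<eta>
  proof -
    obtain M where M: "\<forall>m\<ge>M. \<gamma> m = \<eta> m" "position \<xi> \<gamma> M < position \<xi> \<eta> M"
      using path_less_imp_position_less[OF less \<gamma>\<eta>(1,2)] by blast
    show ?thesis
      using M(2) position_diff[OF M(1), of "max M N" \<xi>] position_diff[OF \<gamma>\<eta>(3), of "max M N" \<xi>]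
      by simp
  qed
  have "path_less \<xi> \<gamma> \<eta>" if less: "position \<xi> \<gamma> N < position \<xi> \<eta> N"
  proof -
    have "\<gamma> \<noteq> \<eta>" using less by auto
    then obtain i where "\<gamma> i \<noteq> \<eta> i" by blast
    define n where "n = Max {i. \<gamma> i \<noteq> \<eta> i}"
    have "{i. \<gamma> i \<noteq> \<eta> i} \<subseteq> {..<N}" using N leI by blast
    then have fin: "finite {i. \<gamma> i \<noteq> \<eta> i}" by (rule finite_subset) simp
    have n: "\<gamma> n \<noteq> \<eta> n" using Max_in[OF fin] \<open>\<gamma> i \<noteq> \<eta> i\<close> by (auto simp: n_def)
    have beyond: "\<forall>m>n. \<gamma> m = \<eta> m" using Max_ge[OF fin] by (fastforce simp: n_def)
    then have target: "vertex \<gamma> (Suc n) = vertex \<eta> (Suc n)" by (simp add: vertex_def)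
    then have "vertex \<gamma> n \<noteq> vertex \<eta> n" using n paths_edge_eq paths by metis
    then have "edge_less \<xi> (\<gamma> n) (\<eta> n) \<or> edge_less \<xi> (\<eta> n) (\<gamma> n)"
      using edge_less_total[of "vertex \<gamma> n" "vertex \<gamma> (Suc n)" "vertex \<eta> n" \<xi>]
        paths_edge[OF paths(1), of n] paths_edge[OF paths(2), of n] target
        paths_edge_eq[OF paths(1), of n] paths_edge_eq[OF paths(2), of n] by simp
    moreover have "\<not> edge_less \<xi> (\<eta> n) (\<gamma> n)"
    proof
      assume "edge_less \<xi> (\<eta> n) (\<gamma> n)"
      moreover have "\<eta> n \<noteq> \<gamma> n" "\<forall>m>n. \<eta> m = \<gamma> m" using n beyond by metis+
      ultimately have "path_less \<xi> \<eta> \<gamma>" unfolding path_less_def by blast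
      from imp[OF this paths(2,1)] N less show False by simp
    qed
    ultimately show ?thesis using n beyond unfolding path_less_def by blast
  qed
  then show ?thesis using imp paths N by blast
qed

text \<open>The paths are cofinal and \<open>\<eta>\<close> is \<open>n\<close> places after \<open>\<gamma>\<close>; the choice of \<open>N\<close> does not matter, by
  \<open>position_diff\<close>. This is the graph of the \<open>n\<close>-th power of the adic map, see \<open>adic_power_iff\<close>.\<close>

definition shifted :: "(vertex \<Rightarrow> bool) \<Rightarrow> int \<Rightarrow> path \<Rightarrow> path \<Rightarrow> bool" where
  "shifted \<xi> n \<gamma> \<eta> \<longleftrightarrow> \<gamma> \<in> paths \<and> \<eta> \<in> paths \<and>
     (\<exists>N. (\<forall>m\<ge>N. \<gamma> m = \<eta> m) \<and> int (position \<xi> \<eta> N) = int (position \<xi> \<gamma> N) + n)"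

lemma shifted_eventually:
  assumes "shifted \<xi> n \<gamma> \<eta>"
  shows "\<exists>N. \<forall>M\<ge>N. (\<forall>m\<ge>M. \<gamma> m = \<eta> m) \<and> int (position \<xi> \<eta> M) = int (position \<xi> \<gamma> M) + n"
proof -
  obtain N where N: "\<forall>m\<ge>N. \<gamma> m = \<eta> m" "int (position \<xi> \<eta> N) = int (position \<xi> \<gamma> N) + n"
    using assms by (auto simp: shifted_def)
  show ?thesis
  proof (intro exI[of _ N] allI impI conjI)
    fix M assume "N \<le> M"
    then show "int (position \<xi> \<eta> M) = int (position \<xi> \<gamma> M) + n"
      using position_diff[OF N(1), of M \<xi>] N(2) by simp
  qed (use N(1) in auto)
qed

lemma shifted_paths: "shifted \<xi> n \<gamma> \<eta> \<Longrightarrow> \<gamma> \<in> paths \<and> \<eta> \<in> paths"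
  by (simp add: shifted_def)

lemma shifted_minus: "shifted \<xi> n \<gamma> \<eta> \<Longrightarrow> shifted \<xi> (- n) \<eta> \<gamma>"
  unfolding shifted_def by (metis add.commute add_minus_cancel)

lemma shifted_trans:
  assumes "shifted \<xi> n \<gamma> \<eta>" "shifted \<xi> m \<eta> \<zeta>"
  shows "shifted \<xi> (n + m) \<gamma> \<zeta>"
proof -
  obtain N where N: "\<forall>M\<ge>N. (\<forall>m\<ge>M. \<gamma> m = \<eta> m) \<and> int (position \<xi> \<eta> M) = int (position \<xi> \<gamma> M) + n"
    using shifted_eventually[OF assms(1)] by blast
  obtain N' where N': "\<forall>M\<ge>N'. (\<forall>m\<ge>M. \<eta> m = \<zeta> m) \<and> int (position \<xi> \<zeta> M) = int (position \<xi> \<eta> M) + m"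
    using shifted_eventually[OF assms(2)] by blast
  show ?thesis
    using N[rule_format, of "max N N'"] N'[rule_format, of "max N N'"]
      shifted_paths[OF assms(1)] shifted_paths[OF assms(2)]
    unfolding shifted_def by (intro conjI exI[of _ "max N N'"]) simp_all
qed

lemma shifted_0: "shifted \<xi> 0 \<gamma> \<eta> \<longleftrightarrow> \<gamma> \<in> paths \<and> \<eta> = \<gamma>"
proof
  assume *: "shifted \<xi> 0 \<gamma> \<eta>"
  then obtain N where N: "\<forall>m\<ge>N. \<gamma> m = \<eta> m" "position \<xi> \<eta> N = position \<xi> \<gamma> N"
    by (auto simp: shifted_def)
  then have "\<forall>i<N. \<gamma> i = \<eta> i"
    using * same_position_imp_same_prefix[of \<gamma> \<eta> N \<xi>] by (simp add: shifted_def vertex_def)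
  then have "\<eta> = \<gamma>" using N(1) by (metis ext not_le)
  then show "\<gamma> \<in> paths \<and> \<eta> = \<gamma>" using * by (simp add: shifted_def)
qed (auto simp: shifted_def)

lemma shifted_unique: "shifted \<xi> n \<gamma> \<eta> \<Longrightarrow> shifted \<xi> n \<gamma> \<zeta> \<Longrightarrow> \<zeta> = \<eta>"
  using shifted_trans[OF shifted_minus, of \<xi> n \<gamma> \<eta> n \<zeta>] shifted_0 by simp

lemma shifted_between:
  assumes "shifted \<xi> n \<gamma> \<zeta>" "0 \<le> m" "m \<le> n"
  shows "\<exists>\<eta>. shifted \<xi> m \<gamma> \<eta>"
proof -
  obtain N where N: "\<forall>i\<ge>N. \<gamma> i = \<zeta> i" "int (position \<xi> \<zeta> N) = int (position \<xi> \<gamma> N) + n"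
    and paths: "\<gamma> \<in> paths" "\<zeta> \<in> paths"
    using assms(1) by (auto simp: shifted_def)
  have "vertex \<gamma> N = vertex \<zeta> N" using N(1) by (simp add: vertex_def)
  then have "position \<xi> \<gamma> N + nat m < num_paths (vertex \<gamma> N)"
    using position_less[OF paths(2), of \<xi> N] N(2) assms(2,3) by simp
  then obtain \<eta> where "\<eta> \<in> paths" "\<forall>i\<ge>N. \<gamma> i = \<eta> i" "position \<xi> \<eta> N = position \<xi> \<gamma> N + nat m"
    using reposition[OF paths(1)] by blast
  then show ?thesis using paths assms(2) unfolding shifted_def
    by (intro exI[of _ \<eta>] conjI exI[of _ N]) simp_all
qed

lemma shifted_imp_smallest_larger:
  assumes "shifted \<xi> 1 \<gamma> \<eta>"
  shows "smallest_larger \<xi> \<gamma> \<eta>"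
proof -
  have paths: "\<gamma> \<in> paths" "\<eta> \<in> paths" using assms by (auto simp: shifted_def)
  obtain N where N: "\<forall>M\<ge>N. (\<forall>m\<ge>M. \<gamma> m = \<eta> m) \<and> int (position \<xi> \<eta> M) = int (position \<xi> \<gamma> M) + 1"
    using shifted_eventually[OF assms] by blast
  have "path_less \<xi> \<gamma> \<eta>" using path_less_iff[OF paths, of N \<xi>] N[rule_format, of N] by simp
  moreover have "\<eta> = \<zeta> \<or> path_less \<xi> \<eta> \<zeta>" if \<zeta>: "\<zeta> \<in> paths" "path_less \<xi> \<gamma> \<zeta>" for \<zeta>
  proof -
    obtain N' where N': "\<forall>m\<ge>N'. \<gamma> m = \<zeta> m"
      using path_less_imp_position_less[OF \<zeta>(2) paths(1) \<zeta>(1)] by blast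
    define M where "M = max N N'"
    have agree: "\<forall>m\<ge>M. \<gamma> m = \<zeta> m" "\<forall>m\<ge>M. \<gamma> m = \<eta> m" "\<forall>m\<ge>M. \<eta> m = \<zeta> m"
      using N N' by (auto simp: M_def)
    have pos: "position \<xi> \<eta> M = position \<xi> \<gamma> M + 1" using N[rule_format, of M] by (simp add: M_def)
    have "position \<xi> \<gamma> M < position \<xi> \<zeta> M"
      using path_less_iff[OF paths(1) \<zeta>(1) agree(1)] \<zeta>(2) by blast
    then consider "position \<xi> \<eta> M = position \<xi> \<zeta> M" | "position \<xi> \<eta> M < position \<xi> \<zeta> M"
      using pos by linarith
    then show ?thesis
    proof cases
      case 1
      then have "shifted \<xi> 0 \<eta> \<zeta>" using paths \<zeta>(1) agree(3) by (auto simp: shifted_def)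
      then show ?thesis by (simp add: shifted_0)
    next
      case 2
      then show ?thesis using path_less_iff[OF paths(2) \<zeta>(1) agree(3)] by blast
    qed
  qed
  ultimately show ?thesis using paths by (auto simp: smallest_larger_def)
qed

lemma smallest_larger_unique:
  assumes "smallest_larger \<xi> \<gamma> \<eta>" "smallest_larger \<xi> \<gamma> \<zeta>"
  shows "\<zeta> = \<eta>"
proof (rule ccontr)
  assume "\<zeta> \<noteq> \<eta>"
  then have less: "path_less \<xi> \<eta> \<zeta>" "path_less \<xi> \<zeta> \<eta>" and paths: "\<eta> \<in> paths" "\<zeta> \<in> paths"
    using assms by (auto simp: smallest_larger_def)
  obtain N where N: "\<forall>m\<ge>N. \<eta> m = \<zeta> m" "position \<xi> \<eta> N < position \<xi> \<zeta> N"
    using path_less_imp_position_less[OF less(1) paths] by blast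
  then show False using path_less_iff[OF paths(2,1), of N \<xi>] less(2) by auto
qed

text \<open>A path has a successor iff at some level its initial segment is not the last one, and the
  initial segment is the last one at all levels iff every edge is maximal.\<close>

lemma successor_exists_iff:
  assumes "\<gamma> \<in> paths"
  shows "(\<exists>\<eta>. shifted \<xi> 1 \<gamma> \<eta>) \<longleftrightarrow> \<not> (\<forall>i. maximal_edge \<xi> (\<gamma> i))"
proof
  assume "\<exists>\<eta>. shifted \<xi> 1 \<gamma> \<eta>"
  then obtain \<eta> N where \<eta>: "\<eta> \<in> paths" "\<forall>m\<ge>N. \<gamma> m = \<eta> m"
    and "int (position \<xi> \<eta> N) = int (position \<xi> \<gamma> N) + 1"
    unfolding shifted_def by blast
  then have next_position: "position \<xi> \<eta> N = position \<xi> \<gamma> N + 1" by linarith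
  show "\<not> (\<forall>i. maximal_edge \<xi> (\<gamma> i))"
  proof
    assume max: "\<forall>i. maximal_edge \<xi> (\<gamma> i)"
    have "position \<xi> \<gamma> n + 1 = num_paths (vertex \<gamma> n)" for n
    proof (induction n)
      case (Suc n)
      have "edge_offset \<xi> (\<gamma> n) + num_paths (vertex \<gamma> n) = num_paths (vertex \<gamma> (Suc n))"
        using max maximal_edge_iff[OF paths_edge[OF assms]] paths_edge_eq[OF assms] by metis
      then show ?case using Suc by (simp add: position_Suc)
    qed (simp add: paths_vertex_0[OF assms])
    moreover have "vertex \<eta> N = vertex \<gamma> N" using \<eta>(2) by (simp add: vertex_def)
    ultimately have "num_paths (vertex \<eta> N) = position \<xi> \<eta> N" using next_position by metis
    with position_less[OF \<eta>(1), of \<xi> N] show False by simp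
  qed
next
  assume "\<not> (\<forall>i. maximal_edge \<xi> (\<gamma> i))"
  then obtain i where "\<not> maximal_edge \<xi> (\<gamma> i)" by blast
  then have "edge_offset \<xi> (\<gamma> i) + num_paths (vertex \<gamma> i) \<noteq> num_paths (vertex \<gamma> (Suc i))"
    using maximal_edge_iff[OF paths_edge[OF assms]] paths_edge_eq[OF assms] by metis
  then have "position \<xi> \<gamma> (Suc i) + 1 < num_paths (vertex \<gamma> (Suc i))"
    using edge_offset_bound[OF paths_edge[OF assms, of i], of \<xi>] paths_edge_eq[OF assms, of i]
      position_less[OF assms, of \<xi> i] by (simp add: position_Suc)
  from reposition[OF assms this, of \<xi>]
  obtain \<eta> where "\<eta> \<in> paths" "\<forall>m\<ge>Suc i. \<gamma> m = \<eta> m" "position \<xi> \<eta> (Suc i) = position \<xi> \<gamma> (Suc i) + 1"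
    by blast
  then have "shifted \<xi> 1 \<gamma> \<eta>" using assms unfolding shifted_def by (intro conjI exI[of _ "Suc i"]) simp_all
  then show "\<exists>\<eta>. shifted \<xi> 1 \<gamma> \<eta>" by blast
qed

lemma predecessor_exists_iff:
  assumes "\<eta> \<in> paths"
  shows "(\<exists>\<gamma>. shifted \<xi> 1 \<gamma> \<eta>) \<longleftrightarrow> \<not> (\<forall>i. minimal_edge \<xi> (\<eta> i))"
proof
  assume "\<exists>\<gamma>. shifted \<xi> 1 \<gamma> \<eta>"
  then obtain \<gamma> N where "int (position \<xi> \<eta> N) = int (position \<xi> \<gamma> N) + 1"
    unfolding shifted_def by blast
  then have N: "position \<xi> \<eta> N = position \<xi> \<gamma> N + 1" by linarith
  show "\<not> (\<forall>i. minimal_edge \<xi> (\<eta> i))"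
  proof
    assume "\<forall>i. minimal_edge \<xi> (\<eta> i)"
    then have "edge_offset \<xi> (\<eta> i) = 0" for i
      using minimal_edge_iff[OF paths_edge[OF assms]] paths_edge_eq[OF assms] by metis
    then show False using N by (simp add: position_def)
  qed
next
  assume "\<not> (\<forall>i. minimal_edge \<xi> (\<eta> i))"
  then obtain i where "\<not> minimal_edge \<xi> (\<eta> i)" by blast
  then have "edge_offset \<xi> (\<eta> i) \<noteq> 0"
    using minimal_edge_iff[OF paths_edge[OF assms]] paths_edge_eq[OF assms] by metis
  then have pos: "position \<xi> \<eta> (Suc i) > 0" by (simp add: position_Suc)
  then have "position \<xi> \<eta> (Suc i) - 1 < num_paths (vertex \<eta> (Suc i))"
    using position_less[OF assms, of \<xi> "Suc i"] by simp
  from reposition[OF assms this, of \<xi>]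
  obtain \<gamma> where "\<gamma> \<in> paths" "\<forall>m\<ge>Suc i. \<eta> m = \<gamma> m" "position \<xi> \<gamma> (Suc i) = position \<xi> \<eta> (Suc i) - 1"
    by blast
  then have "shifted \<xi> (- 1) \<eta> \<gamma>" using assms pos unfolding shifted_def by (intro conjI exI[of _ "Suc i"]) simp_all
  then show "\<exists>\<gamma>. shifted \<xi> 1 \<gamma> \<eta>" using shifted_minus by fastforce
qed

lemma adic_iff:
  assumes "\<gamma> \<in> paths"
  shows "adic \<xi> \<gamma> = Some \<eta> \<longleftrightarrow> shifted \<xi> 1 \<gamma> \<eta>"
proof (cases "\<exists>\<zeta>. shifted \<xi> 1 \<gamma> \<zeta>")
  case True
  then obtain \<zeta> where \<zeta>: "shifted \<xi> 1 \<gamma> \<zeta>" by blast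
  have "(THE \<eta>. smallest_larger \<xi> \<gamma> \<eta>) = \<zeta>"
    by (rule the_equality) (use \<zeta> shifted_imp_smallest_larger smallest_larger_unique in blast)+
  then have "adic \<xi> \<gamma> = Some \<zeta>"
    using successor_exists_iff[OF assms] True unfolding adic_def by auto
  then show ?thesis using \<zeta> shifted_unique by auto
next
  case False
  then have "adic \<xi> \<gamma> = None" using successor_exists_iff[OF assms, of \<xi>] by (simp add: adic_def)
  with False show ?thesis by auto
qed

lemma adic_inv_iff:
  assumes "\<eta> \<in> paths"
  shows "adic_inv \<xi> \<eta> = Some \<gamma> \<longleftrightarrow> shifted \<xi> 1 \<gamma> \<eta>"
proof (cases "\<exists>\<zeta>. shifted \<xi> 1 \<zeta> \<eta>")
  case True
  then obtain \<zeta> where \<zeta>: "shifted \<xi> 1 \<zeta> \<eta>" by blast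
  have uniq: "\<gamma> = \<zeta>" if "shifted \<xi> 1 \<gamma> \<eta>" for \<gamma>
    using shifted_unique[OF shifted_minus[OF \<zeta>] shifted_minus[OF that]] by simp
  have "(THE \<gamma>. \<gamma> \<in> paths \<and> adic \<xi> \<gamma> = Some \<eta>) = \<zeta>"
    by (rule the_equality) (use \<zeta> uniq adic_iff shifted_paths in blast)+
  then have "adic_inv \<xi> \<eta> = Some \<zeta>"
    using predecessor_exists_iff[OF assms] True unfolding adic_inv_def by auto
  then show ?thesis using \<zeta> uniq by (metis option.inject)
next
  case False
  then have "adic_inv \<xi> \<eta> = None" using predecessor_exists_iff[OF assms, of \<xi>] by (simp add: adic_inv_def)
  with False show ?thesis by auto
qed

text \<open>Intermediate iterates exist whenever the endpoint does, since positions between two occupied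
  positions of the same block are occupied as well (\<open>shifted_between\<close>).\<close>

lemma adic_power_iff:
  assumes "\<gamma> \<in> paths"
  shows "adic_power \<xi> n \<gamma> = Some \<eta> \<longleftrightarrow> shifted \<xi> n \<gamma> \<eta>"
proof -
  have up: "((\<lambda>p. Option.bind p (adic \<xi>)) ^^ m) (Some \<gamma>) = Some \<eta> \<longleftrightarrow> shifted \<xi> (int m) \<gamma> \<eta>" for m \<eta>
  proof (induction m arbitrary: \<eta>)
    case 0
    then show ?case using assms by (auto simp: shifted_0)
  next
    case (Suc m)
    have "((\<lambda>p. Option.bind p (adic \<xi>)) ^^ Suc m) (Some \<gamma>) = Some \<eta>
        \<longleftrightarrow> (\<exists>\<zeta>. shifted \<xi> (int m) \<gamma> \<zeta> \<and> adic \<xi> \<zeta> = Some \<eta>)"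
      using Suc by (auto simp: bind_eq_Some_conv)
    also have "\<dots> \<longleftrightarrow> (\<exists>\<zeta>. shifted \<xi> (int m) \<gamma> \<zeta> \<and> shifted \<xi> 1 \<zeta> \<eta>)"
      using adic_iff shifted_paths by blast
    also have "\<dots> \<longleftrightarrow> shifted \<xi> (int (Suc m)) \<gamma> \<eta>"
    proof
      assume "\<exists>\<zeta>. shifted \<xi> (int m) \<gamma> \<zeta> \<and> shifted \<xi> 1 \<zeta> \<eta>"
      then show "shifted \<xi> (int (Suc m)) \<gamma> \<eta>" using shifted_trans[of \<xi> "int m" \<gamma> _ 1 \<eta>] by (auto simp: add.commute)
    next
      assume *: "shifted \<xi> (int (Suc m)) \<gamma> \<eta>"
      then obtain \<zeta> where \<zeta>: "shifted \<xi> (int m) \<gamma> \<zeta>"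
        using shifted_between[of \<xi> "int (Suc m)" \<gamma> \<eta> "int m"] by auto
      have "shifted \<xi> 1 \<zeta> \<eta>" using shifted_trans[OF shifted_minus[OF \<zeta>] *] by simp
      with \<zeta> show "\<exists>\<zeta>. shifted \<xi> (int m) \<gamma> \<zeta> \<and> shifted \<xi> 1 \<zeta> \<eta>" by blast
    qed
    finally show ?case .
  qed
  have down: "((\<lambda>p. Option.bind p (adic_inv \<xi>)) ^^ m) (Some \<gamma>) = Some \<eta> \<longleftrightarrow> shifted \<xi> (int m) \<eta> \<gamma>" for m \<eta>
  proof (induction m arbitrary: \<eta>)
    case 0
    then show ?case using assms by (auto simp: shifted_0)
  next
    case (Suc m)
    have "((\<lambda>p. Option.bind p (adic_inv \<xi>)) ^^ Suc m) (Some \<gamma>) = Some \<eta>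
        \<longleftrightarrow> (\<exists>\<zeta>. shifted \<xi> (int m) \<zeta> \<gamma> \<and> adic_inv \<xi> \<zeta> = Some \<eta>)"
      using Suc by (auto simp: bind_eq_Some_conv)
    also have "\<dots> \<longleftrightarrow> (\<exists>\<zeta>. shifted \<xi> (int m) \<zeta> \<gamma> \<and> shifted \<xi> 1 \<eta> \<zeta>)"
      using adic_inv_iff shifted_paths by blast
    also have "\<dots> \<longleftrightarrow> shifted \<xi> (int (Suc m)) \<eta> \<gamma>"
    proof
      assume "\<exists>\<zeta>. shifted \<xi> (int m) \<zeta> \<gamma> \<and> shifted \<xi> 1 \<eta> \<zeta>"
      then show "shifted \<xi> (int (Suc m)) \<eta> \<gamma>" using shifted_trans[of \<xi> 1 \<eta> _ "int m" \<gamma>] by auto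
    next
      assume *: "shifted \<xi> (int (Suc m)) \<eta> \<gamma>"
      then obtain \<zeta> where \<zeta>: "shifted \<xi> 1 \<eta> \<zeta>"
        using shifted_between[of \<xi> "int (Suc m)" \<eta> \<gamma> 1] by auto
      have "shifted \<xi> (int m) \<zeta> \<gamma>" using shifted_trans[OF shifted_minus[OF \<zeta>] *] by simp
      with \<zeta> show "\<exists>\<zeta>. shifted \<xi> (int m) \<zeta> \<gamma> \<and> shifted \<xi> 1 \<eta> \<zeta>" by blast
    qed
    finally show ?case .
  qed
  show ?thesis
  proof (cases "0 \<le> n")
    case True
    then show ?thesis using up[of "nat n"] by (simp add: adic_power_def)
  next
    case False
    then have "adic_power \<xi> n \<gamma> = Some \<eta> \<longleftrightarrow> shifted \<xi> (- n) \<eta> \<gamma>"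
      using down[of "nat (- n)"] by (simp add: adic_power_def)
    then show ?thesis using shifted_minus[of \<xi> n \<gamma> \<eta>] shifted_minus[of \<xi> "- n" \<eta> \<gamma>] by auto
  qed
qed

section \<open>Blocks as words of the subshift\<close>

text \<open>For \<open>k \<le> level v\<close> the letter does not depend on the chosen path, because \<open>v\<close> and \<open>i\<close> determine
  its first \<open>level v\<close> edges.\<close>

definition block_letter :: "(vertex \<Rightarrow> bool) \<Rightarrow> nat \<Rightarrow> vertex \<Rightarrow> nat \<Rightarrow> path set" where
  "block_letter \<xi> k v i =
     cylinder k (SOME \<gamma>. \<gamma> \<in> paths \<and> vertex \<gamma> (level v) = v \<and> position \<xi> \<gamma> (level v) = i)"

lemma block_letter_eq:
  assumes "\<gamma> \<in> paths" "k \<le> N"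
  shows "block_letter \<xi> k (vertex \<gamma> N) (position \<xi> \<gamma> N) = cylinder k \<gamma>"
proof -
  have N: "level (vertex \<gamma> N) = N" by (rule level_vertex[OF assms(1)])
  define \<eta> where "\<eta> = (SOME \<eta>. \<eta> \<in> paths \<and> vertex \<eta> N = vertex \<gamma> N \<and> position \<xi> \<eta> N = position \<xi> \<gamma> N)"
  have "\<eta> \<in> paths \<and> vertex \<eta> N = vertex \<gamma> N \<and> position \<xi> \<eta> N = position \<xi> \<gamma> N"
    unfolding \<eta>_def by (rule someI[of _ \<gamma>]) (simp add: assms(1))
  then have "\<forall>i<N. \<eta> i = \<gamma> i" using assms(1) by (intro same_position_imp_same_prefix) auto
  then have "cylinder k \<eta> = cylinder k \<gamma>" using assms(2) by (auto simp: cylinder_def)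
  then show ?thesis by (simp add: block_letter_def N \<eta>_def)
qed

lemma block_letter_copy:
  assumes "copy \<xi> a v s" "k \<le> level a" "i < num_paths a"
  shows "block_letter \<xi> k v (s + i) = block_letter \<xi> k a i"
  using assms(1)
proof (induction rule: copy.induct)
  case (step u s v)
  have "s + i < num_paths u" using copy_bound[OF step(1)] assms(3) by simp
  then obtain \<gamma> where \<gamma>: "\<gamma> \<in> paths" "vertex \<gamma> (level u) = u" "position \<xi> \<gamma> (level u) = s + i"
    using path_exists by blast
  then obtain \<eta> where \<eta>: "\<eta> \<in> paths" "\<forall>m<level u. \<eta> m = \<gamma> m" "vertex \<eta> (level u) = u"
      "vertex \<eta> (Suc (level u)) = v"
    using path_extend[of \<gamma> "level u" v] step(2) by auto
  have pos: "position \<xi> \<eta> (level u) = s + i" using \<eta>(2) \<gamma>(3) by (simp add: position_def)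
  then have pos': "position \<xi> \<eta> (Suc (level u)) = s + edge_offset \<xi> (u, v) + i"
    using paths_edge_eq[OF \<eta>(1), of "level u"] \<eta>(3,4) by (simp add: position_Suc)
  have k: "k \<le> level u" using copy_level[OF step(1)] assms(2) by simp
  have "block_letter \<xi> k v (s + edge_offset \<xi> (u, v) + i) = cylinder k \<eta>"
    using block_letter_eq[OF \<eta>(1), of k "Suc (level u)" \<xi>] k pos' \<eta>(4) by simp
  also have "\<dots> = block_letter \<xi> k u (s + i)"
    using block_letter_eq[OF \<eta>(1) k, of \<xi>] pos \<eta>(3) by simp
  finally show ?case using step.IH by simp
qed simp

lemma block_letter_in_partition:
  assumes "i < num_paths v" "k \<le> level v"
  shows "block_letter \<xi> k v i \<in> cylinder_partition k"
proof -
  obtain \<gamma> where "\<gamma> \<in> paths" "vertex \<gamma> (level v) = v" "position \<xi> \<gamma> (level v) = i"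
    using path_exists[OF assms(1)] by blast
  then show ?thesis using block_letter_eq[of \<gamma> k "level v" \<xi>] assms(2)
    by (auto simp: cylinder_partition_def)
qed

lemma coding_eq_Some_iff:
  "\<gamma> \<in> paths \<Longrightarrow> coding \<xi> k \<gamma> n = Some C \<longleftrightarrow> (\<exists>\<eta>. shifted \<xi> n \<gamma> \<eta> \<and> C = cylinder k \<eta>)"
  by (auto simp: coding_def adic_power_iff)

lemma coding_block:
  assumes "\<gamma> \<in> paths" "k \<le> N" "i < num_paths (vertex \<gamma> N)"
  shows "coding \<xi> k \<gamma> (int i - int (position \<xi> \<gamma> N)) = Some (block_letter \<xi> k (vertex \<gamma> N) i)"
proof -
  obtain \<eta> where \<eta>: "\<eta> \<in> paths" "\<forall>m\<ge>N. \<gamma> m = \<eta> m" "position \<xi> \<eta> N = i"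
    using reposition[OF assms(1,3)] by blast
  then have "shifted \<xi> (int i - int (position \<xi> \<gamma> N)) \<gamma> \<eta>"
    using assms(1) unfolding shifted_def by (intro conjI exI[of _ N]) simp_all
  moreover have "vertex \<eta> N = vertex \<gamma> N" using \<eta>(2) by (simp add: vertex_def)
  ultimately show ?thesis
    using block_letter_eq[OF \<eta>(1) assms(2), of \<xi>] \<eta>(3) coding_eq_Some_iff[OF assms(1)] by metis
qed

text \<open>The finitely many paths visited during the window are cofinal, so from some level on they pass
  through a common vertex \<open>v\<close>, and their positions at \<open>v\<close> are consecutive.\<close>

lemma window_in_block:
  assumes "\<omega> \<in> adic_subshift \<xi> k"
  shows "\<exists>v p. k \<le> level v \<and> p + l \<le> num_paths v \<and> (\<forall>i<l. \<omega> (a + int i) = block_letter \<xi> k v (p + i))"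
proof (cases "l = 0")
  case True
  then show ?thesis by (intro exI[of _ "(k, 0)"] exI[of _ 0]) (simp add: level_def)
next
  case False
  obtain \<gamma> j where \<gamma>: "\<gamma> \<in> paths" and j: "\<forall>i<l. coding \<xi> k \<gamma> (j + int i) = Some (\<omega> (a + int i))"
    using assms unfolding adic_subshift_def by blast
  obtain \<eta> where \<eta>: "shifted \<xi> j \<gamma> \<eta>"
    using j[rule_format, of 0] False coding_eq_Some_iff[OF \<gamma>] by auto
  obtain \<zeta> where \<zeta>: "shifted \<xi> (j + int (l - 1)) \<gamma> \<zeta>"
    using j[rule_format, of "l - 1"] False coding_eq_Some_iff[OF \<gamma>] by auto
  obtain N1 where N1: "\<forall>M\<ge>N1. (\<forall>m\<ge>M. \<gamma> m = \<eta> m) \<and> int (position \<xi> \<eta> M) = int (position \<xi> \<gamma> M) + j"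
    using shifted_eventually[OF \<eta>] by blast
  obtain N2 where N2: "\<forall>M\<ge>N2. (\<forall>m\<ge>M. \<gamma> m = \<zeta> m) \<and>
      int (position \<xi> \<zeta> M) = int (position \<xi> \<gamma> M) + (j + int (l - 1))"
    using shifted_eventually[OF \<zeta>] by blast
  define M where "M = max k (max N1 N2)"
  define v where "v = vertex \<gamma> M"
  have M: "k \<le> M" "N1 \<le> M" "N2 \<le> M" by (auto simp: M_def)
  have 1: "int (position \<xi> \<eta> M) = int (position \<xi> \<gamma> M) + j"
    using N1 M(2) by blast
  have 2: "int (position \<xi> \<zeta> M) = int (position \<xi> \<gamma> M) + (j + int (l - 1))" "\<gamma> M = \<zeta> M"
    using N2 M(3) by blast+
  have "position \<xi> \<zeta> M < num_paths v"
    using position_less[of \<zeta> \<xi> M] \<zeta> 2(2) by (simp add: shifted_def v_def vertex_def)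
  moreover have "position \<xi> \<zeta> M = position \<xi> \<eta> M + (l - 1)" using 1 2(1) by linarith
  ultimately have len: "position \<xi> \<eta> M + l \<le> num_paths v" using False by linarith
  have "\<omega> (a + int i) = block_letter \<xi> k v (position \<xi> \<eta> M + i)" if "i < l" for i
  proof -
    have "coding \<xi> k \<gamma> (int (position \<xi> \<eta> M + i) - int (position \<xi> \<gamma> M)) = Some (block_letter \<xi> k v (position \<xi> \<eta> M + i))"
      unfolding v_def by (rule coding_block) (use \<gamma> len that M(1) in \<open>simp_all add: v_def\<close>)
    moreover have "int (position \<xi> \<eta> M + i) - int (position \<xi> \<gamma> M) = j + int i" using 1 by simp
    ultimately show ?thesis using j that by (metis option.inject)
  qed
  moreover have "k \<le> level v" using level_vertex[OF \<gamma>] M(1) by (simp add: v_def)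
  ultimately show ?thesis using len by blast
qed

lemma window_in_larger_blocks:
  assumes "\<omega> \<in> adic_subshift \<xi> k"
  shows "\<exists>v. k \<le> level v \<and> (\<forall>w. fst v \<le> fst w \<longrightarrow> snd v \<le> snd w \<longrightarrow>
    (\<exists>p. p + l \<le> num_paths w \<and> (\<forall>i<l. \<omega> (a + int i) = block_letter \<xi> k w (p + i))))"
proof -
  obtain v p where v: "k \<le> level v" "p + l \<le> num_paths v"
    "\<forall>i<l. \<omega> (a + int i) = block_letter \<xi> k v (p + i)"
    using window_in_block[OF assms] by blast
  have "\<exists>p. p + l \<le> num_paths w \<and> (\<forall>i<l. \<omega> (a + int i) = block_letter \<xi> k w (p + i))"
    if "fst v \<le> fst w" "snd v \<le> snd w" for w
  proof -
    obtain s where s: "copy \<xi> v w s" using copy_exists \<open>fst v \<le> fst w\<close> \<open>snd v \<le> snd w\<close> by blast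
    show ?thesis
      using copy_bound[OF s] v block_letter_copy[OF s v(1)]
      by (intro exI[of _ "s + p"]) (auto simp: add.assoc)
  qed
  with v(1) show ?thesis by blast
qed

text \<open>In the block of \<open>(x + 1, y + 1)\<close> one copy of the block of \<open>(x, y)\<close> does not reach the left end
  and another one does not reach the right end. Doing this twice gives a copy with both properties.\<close>

lemma copy_margins:
  "\<exists>s. copy \<xi> (x, y) (x + 2, y + 2) s \<and> 1 \<le> s \<and> s + num_paths (x, y) < num_paths (x + 2, y + 2)"
proof -
  have *: "\<exists>s t. copy \<xi> (x, y) (Suc x, Suc y) s \<and> copy \<xi> (x, y) (Suc x, Suc y) t
      \<and> 1 \<le> s \<and> t + num_paths (x, y) < num_paths (Suc x, Suc y)" for x y
  proof -
    obtain u1 u2 where u: "{u. (u, (Suc x, Suc y)) \<in> pascal_edges} = {u1, u2}"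
      "edge_offset \<xi> (u1, (Suc x, Suc y)) = 0"
      "edge_offset \<xi> (u2, (Suc x, Suc y)) = num_paths u1"
      "num_paths (Suc x, Suc y) = num_paths u1 + num_paths u2"
      using interior_sources[of x y \<xi>] by metis
    have "u1 \<in> {(x, Suc y), (Suc x, y)}" "u2 \<in> {(x, Suc y), (Suc x, y)}"
      using u(1) sources_eq[of "Suc x" "Suc y"] by auto
    then have E: "((x, y), u1) \<in> pascal_edges" "((x, y), u2) \<in> pascal_edges"
      by (auto simp: pascal_edges_iff)
    have E': "(u1, (Suc x, Suc y)) \<in> pascal_edges" "(u2, (Suc x, Suc y)) \<in> pascal_edges"
      using u(1) by blast+
    note c1 = copy.step[OF copy.step[OF copy.self E(1)] E'(1), of \<xi>, unfolded u(2)]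
    note c2 = copy.step[OF copy.step[OF copy.self E(2)] E'(2), of \<xi>, unfolded u(3)]
    show ?thesis
      using c1 c2 num_paths_pos[of u1] num_paths_pos[of u2] edge_offset_bound[OF E(1), of \<xi>] u(4)
      by (intro exI[of _ "0 + edge_offset \<xi> ((x, y), u2) + num_paths u1"]
          exI[of _ "0 + edge_offset \<xi> ((x, y), u1) + 0"] conjI) simp_all
  qed
  obtain s where s: "copy \<xi> (x, y) (Suc x, Suc y) s" "1 \<le> s" using * by blast
  obtain t where t: "copy \<xi> (Suc x, Suc y) (x + 2, y + 2) t"
    "t + num_paths (Suc x, Suc y) < num_paths (x + 2, y + 2)"
    using *[of "Suc x" "Suc y"] by auto
  show ?thesis
    using copy_trans[OF t(1) s(1)] s(2) t(2) copy_bound[OF s(1)] by (intro exI[of _ "s + t"]) simp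
qed

text \<open>Iterating \<open>copy_margins\<close> produces nested blocks that grow on both sides, hence a two-sided
  sequence all of whose windows are factors of blocks and therefore occur in codings of orbits.\<close>

lemma block_extends:
  assumes "k \<le> level w"
  shows "\<exists>\<omega>\<in>adic_subshift \<xi> k. \<forall>i<num_paths w. \<omega> (int i) = block_letter \<xi> k w i"
proof -
  \<comment> \<open>The block of \<open>W n\<close> occupies the interval from \<open>- Q n\<close> to \<open>num_paths (W n) - Q n\<close>, which
      contains \<open>i\<close> as soon as \<open>n \<ge> \<bar>i\<bar>\<close>.\<close>
  define W where "W n = (fst w + 2 * n, snd w + 2 * n)" for n
  have "\<exists>s. copy \<xi> (W n) (W (Suc n)) s \<and> 1 \<le> s \<and> s + num_paths (W n) < num_paths (W (Suc n))" for n
    using copy_margins[of \<xi> "fst w + 2 * n" "snd w + 2 * n"] by (simp add: W_def)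
  then obtain S where S: "\<And>n. copy \<xi> (W n) (W (Suc n)) (S n)" "\<And>n. 1 \<le> S n"
    "\<And>n. S n + num_paths (W n) < num_paths (W (Suc n))" by metis
  define Q where "Q n = (\<Sum>j<n. S j)" for n
  have Q_ge: "n \<le> Q n" for n
    by (induction n) (use S(2) in \<open>auto simp: Q_def add_mono Suc_leI intro: le_trans\<close>)
  have right: "num_paths w + n + Q n \<le> num_paths (W n)" for n
  proof (induction n)
    case (Suc n)
    then show ?case using S(3)[of n] by (simp add: Q_def)
  qed (simp add: Q_def W_def)
  have Q_mono: "m \<le> n \<Longrightarrow> Q m \<le> Q n" for m n
    unfolding Q_def by (intro sum_mono2) auto
  have copies: "copy \<xi> (W m) (W n) (Q n - Q m)" if "m \<le> n" for m n
    using that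
  proof (induction n rule: dec_induct)
    case (step n)
    then show ?case using copy_trans[OF S(1)[of n] step.IH] Q_mono[OF step(1)] by (simp add: Q_def)
  qed (simp add: copy.self)
  have k: "k \<le> level (W n)" for n using assms by (simp add: W_def level_def)
  define \<omega> where "\<omega> i = block_letter \<xi> k (W (nat \<bar>i\<bar>)) (nat (i + int (Q (nat \<bar>i\<bar>))))" for i :: int
  have inside: "0 \<le> i + int (Q n)" "nat (i + int (Q n)) < num_paths (W n)" if "nat \<bar>i\<bar> \<le> n" for i n
    using that Q_ge[of n] right[of n] num_paths_pos[of w] by linarith+
  have \<omega>_eq: "\<omega> i = block_letter \<xi> k (W n) (nat (i + int (Q n)))" if "nat \<bar>i\<bar> \<le> n" for i n
  proof -
    let ?m = "nat \<bar>i\<bar>"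
    have "nat (i + int (Q n)) = Q n - Q ?m + nat (i + int (Q ?m))"
      using Q_mono[OF that] inside(1)[of i ?m] by linarith
    then show ?thesis
      using block_letter_copy[OF copies[OF that] k inside(2)[of i ?m]] by (simp add: \<omega>_def)
  qed
  have "\<omega> \<in> adic_subshift \<xi> k"
    unfolding adic_subshift_def
  proof (intro CollectI conjI allI)
    show "\<omega> n \<in> cylinder_partition k" for n
      unfolding \<omega>_def using inside k by (intro block_letter_in_partition) auto
    fix a :: int and l :: nat
    define n where "n = nat \<bar>a\<bar> + l"
    obtain \<gamma> where \<gamma>: "\<gamma> \<in> paths" "vertex \<gamma> (level (W n)) = W n" "position \<xi> \<gamma> (level (W n)) = 0"
      using path_exists[OF num_paths_pos] by blast
    have "coding \<xi> k \<gamma> (a + int (Q n) + int i) = Some (\<omega> (a + int i))" if "i < l" for i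
    proof -
      have le: "nat \<bar>a + int i\<bar> \<le> n" using that unfolding n_def by linarith
      have "coding \<xi> k \<gamma> (int (nat (a + int i + int (Q n))) - int (position \<xi> \<gamma> (level (W n))))
          = Some (block_letter \<xi> k (vertex \<gamma> (level (W n))) (nat (a + int i + int (Q n))))"
        by (rule coding_block) (use \<gamma> k inside(2)[OF le] in auto)
      then show ?thesis using \<omega>_eq[OF le] inside(1)[OF le] \<gamma>(2,3) by (simp add: ac_simps)
    qed
    with \<gamma>(1) show "\<exists>\<gamma>\<in>paths. \<exists>j. \<forall>i<l. coding \<xi> k \<gamma> (j + int i) = Some (\<omega> (a + int i))" by blast
  qed
  moreover have "\<omega> (int i) = block_letter \<xi> k w i" if "i < num_paths w" for i
  proof -
    have "W 0 = w" "Q 0 = 0" by (simp_all add: W_def Q_def)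
    then show ?thesis
      using block_letter_copy[OF copies[of 0 i] k, of i] \<omega>_eq[of "int i" i] that
      by (simp add: nat_add_distrib add.commute)
  qed
  ultimately show ?thesis by blast
qed

lemma adic_subshift_translate:
  assumes "\<omega> \<in> adic_subshift \<xi> k"
  shows "(\<lambda>i. \<omega> (i + c)) \<in> adic_subshift \<xi> k"
proof -
  have "\<exists>\<gamma>\<in>paths. \<exists>j. \<forall>i<l. coding \<xi> k \<gamma> (j + int i) = Some (\<omega> (a + int i + c))" for a l
  proof -
    have "\<exists>\<gamma>\<in>paths. \<exists>j. \<forall>i<l. coding \<xi> k \<gamma> (j + int i) = Some (\<omega> ((a + c) + int i))"
      using assms unfolding adic_subshift_def by blast
    then show ?thesis by (simp add: ac_simps)
  qed
  with assms show ?thesis by (simp add: adic_subshift_def)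
qed

lemma funpow_shift: "(shift ^^ n) \<omega> i = \<omega> (i + int n)"
  by (induction n arbitrary: i) (simp_all add: shift_def ac_simps)

section \<open>Weak mixing\<close>

text \<open>Two windows of the block of \<open>w\<close> occur at a given distance in the subshift if it agrees with a
  return time of \<open>w\<close> up to the relative position of the windows.\<close>

lemma subshift_joins_windows:
  assumes "k \<le> level w" "r \<in> returns \<xi> w"
    and "p + l \<le> num_paths w" "q + l \<le> num_paths w"
    and n: "int n = r + int q - int p"
  shows "\<exists>\<omega>\<in>adic_subshift \<xi> k. \<forall>i<l. \<omega> (a + int i) = block_letter \<xi> k w (p + i) \<and>
      (shift ^^ n) \<omega> (a + int i) = block_letter \<xi> k w (q + i)"
proof -
  obtain v s t where v: "copy \<xi> w v s" "copy \<xi> w v t" "r = int t - int s"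
    using assms(2) by (auto simp: returns_def)
  have kv: "k \<le> level v" using copy_level[OF v(1)] assms(1) by simp
  obtain \<omega> where \<omega>: "\<omega> \<in> adic_subshift \<xi> k" "\<forall>i<num_paths v. \<omega> (int i) = block_letter \<xi> k v i"
    using block_extends[OF kv] by blast
  have at: "\<omega> (int (u + (c + i))) = block_letter \<xi> k w (c + i)"
    if "copy \<xi> w v u" "c + l \<le> num_paths w" "i < l" for u c i
  proof -
    have "u + (c + i) < num_paths v" using copy_bound[OF that(1)] that(2,3) by simp
    with \<omega>(2) have "\<omega> (int (u + (c + i))) = block_letter \<xi> k v (u + (c + i))" by blast
    also have "\<dots> = block_letter \<xi> k w (c + i)"
      using that(2,3) by (intro block_letter_copy[OF that(1) assms(1)]) simp
    finally show ?thesis .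
  qed
  let ?\<omega> = "\<lambda>i. \<omega> (i + (int s + int p - a))"
  show ?thesis
  proof (intro bexI[of _ ?\<omega>] allI impI conjI)
    fix i assume i: "i < l"
    show "?\<omega> (a + int i) = block_letter \<xi> k w (p + i)"
      using at[OF v(1) assms(3) i] by (simp add: algebra_simps)
    have "a + int i + int n + (int s + int p - a) = int (t + (q + i))"
      using n v(3) by simp
    then show "(shift ^^ n) ?\<omega> (a + int i) = block_letter \<xi> k w (q + i)"
      unfolding funpow_shift using at[OF v(2) assms(4) i] by (simp only:)
  qed (rule adic_subshift_translate[OF \<omega>(1)])
qed

text \<open>Basic open sets of the product topology restrict finitely many coordinates, all of which lie in a
  centred window.\<close>

lemma open_contains_window:
  assumes "openin (adic_subshift_topology \<xi> k) U" "\<omega> \<in> U"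
  shows "\<omega> \<in> adic_subshift \<xi> k"
    and "\<exists>m::nat. \<forall>\<omega>'\<in>adic_subshift \<xi> k. (\<forall>i. \<bar>i\<bar> \<le> int m \<longrightarrow> \<omega>' i = \<omega> i) \<longrightarrow> \<omega>' \<in> U"
proof -
  obtain S where S: "openin (product_topology (\<lambda>_. discrete_topology (cylinder_partition k)) UNIV) S"
    "U = S \<inter> adic_subshift \<xi> k"
    using assms(1) unfolding adic_subshift_topology_def openin_subtopology by blast
  show "\<omega> \<in> adic_subshift \<xi> k" using assms(2) S(2) by blast
  obtain B where B: "finite {i. B i \<noteq> cylinder_partition k}" "\<omega> \<in> Pi\<^sub>E UNIV B" "Pi\<^sub>E UNIV B \<subseteq> S"
  proof -
    have "\<omega> \<in> S" using assms(2) S(2) by blast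
    then show ?thesis using S(1) that unfolding openin_product_topology_alt by fastforce
  qed
  obtain m :: nat where m: "\<And>i. B i \<noteq> cylinder_partition k \<Longrightarrow> \<bar>i\<bar> \<le> int m"
  proof
    fix i assume "B i \<noteq> cylinder_partition k"
    then have "nat \<bar>i\<bar> \<le> (\<Sum>i\<in>{i. B i \<noteq> cylinder_partition k}. nat \<bar>i\<bar>)"
      using B(1) by (intro member_le_sum) auto
    then show "\<bar>i\<bar> \<le> int (\<Sum>i\<in>{i. B i \<noteq> cylinder_partition k}. nat \<bar>i\<bar>)" by linarith
  qed
  show "\<exists>m::nat. \<forall>\<omega>'\<in>adic_subshift \<xi> k. (\<forall>i. \<bar>i\<bar> \<le> int m \<longrightarrow> \<omega>' i = \<omega> i) \<longrightarrow> \<omega>' \<in> U"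
  proof (intro exI ballI impI)
    fix \<omega>' assume \<omega>': "\<omega>' \<in> adic_subshift \<xi> k" "\<forall>i. \<bar>i\<bar> \<le> int m \<longrightarrow> \<omega>' i = \<omega> i"
    have "\<omega>' i \<in> B i" for i
    proof (cases "B i = cylinder_partition k")
      case True
      then show ?thesis using \<omega>'(1) by (simp add: adic_subshift_def)
    next
      case False
      then have "\<omega>' i = \<omega> i" using m \<omega>'(2) by blast
      then show ?thesis using B(2) by (auto simp: PiE_def)
    qed
    then have "\<omega>' \<in> S" using B(3) by auto
    then show "\<omega>' \<in> U" using \<omega>'(1) S(2) by blast
  qed
qed

lemma funpow_map_prod:
  fixes f :: "'a \<Rightarrow> 'a" and g :: "'b \<Rightarrow> 'b"
  shows "(map_prod f g ^^ n) (x, y) = ((f ^^ n) x, (g ^^ n) y)"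
  by (induction n) simp_all

theorem theorem4p2:
  fixes \<xi> :: "vertex \<Rightarrow> bool" and k :: nat
  assumes "k \<ge> 1"
  shows "topologically_weakly_mixing (adic_subshift_topology \<xi> k) shift"
  unfolding topologically_weakly_mixing_def topologically_transitive_def
proof (intro allI impI)
  let ?X = "adic_subshift_topology \<xi> k" and ?\<Sigma> = "adic_subshift \<xi> k"
  fix U V
  assume *: "openin (prod_topology ?X ?X) U \<and> U \<noteq> {} \<and> openin (prod_topology ?X ?X) V \<and> V \<noteq> {}"
  then obtain \<alpha>1 \<alpha>2 where "(\<alpha>1, \<alpha>2) \<in> U" by fastforce
  then obtain U1 U2 where U: "openin ?X U1" "openin ?X U2" "\<alpha>1 \<in> U1" "\<alpha>2 \<in> U2" "U1 \<times> U2 \<subseteq> U"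
    using * unfolding openin_prod_topology_alt by blast
  obtain \<beta>1 \<beta>2 where "(\<beta>1, \<beta>2) \<in> V" using * by fastforce
  then obtain V1 V2 where V: "openin ?X V1" "openin ?X V2" "\<beta>1 \<in> V1" "\<beta>2 \<in> V2" "V1 \<times> V2 \<subseteq> V"
    using * unfolding openin_prod_topology_alt by blast
  have window: "\<exists>m. \<forall>l\<ge>m. \<forall>\<omega>\<in>?\<Sigma>. (\<forall>i<2 * l + 1. \<omega> (- int l + int i) = \<alpha> (- int l + int i)) \<longrightarrow> \<omega> \<in> A"
    if A: "openin ?X A" "\<alpha> \<in> A" for A \<alpha>
  proof -
    obtain m :: nat where m: "\<forall>\<omega>'\<in>?\<Sigma>. (\<forall>i. \<bar>i\<bar> \<le> int m \<longrightarrow> \<omega>' i = \<alpha> i) \<longrightarrow> \<omega>' \<in> A"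
      using open_contains_window(2)[OF A] by blast
    have "\<omega> i = \<alpha> i" if "m \<le> l" "\<forall>i<2 * l + 1. \<omega> (- int l + int i) = \<alpha> (- int l + int i)" "\<bar>i\<bar> \<le> int m"
      for l \<omega> i
    proof -
      have "nat (i + int l) < 2 * l + 1" "- int l + int (nat (i + int l)) = i"
        using that(1,3) by linarith+
      with that(2) show ?thesis by metis
    qed
    with m show ?thesis by blast
  qed
  obtain m1 where m1: "\<forall>l\<ge>m1. \<forall>\<omega>\<in>?\<Sigma>.
      (\<forall>i<2 * l + 1. \<omega> (- int l + int i) = \<alpha>1 (- int l + int i)) \<longrightarrow> \<omega> \<in> U1"
    using window[OF U(1,3)] by blast
  obtain m2 where m2: "\<forall>l\<ge>m2. \<forall>\<omega>\<in>?\<Sigma>.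
      (\<forall>i<2 * l + 1. \<omega> (- int l + int i) = \<alpha>2 (- int l + int i)) \<longrightarrow> \<omega> \<in> U2"
    using window[OF U(2,4)] by blast
  obtain m3 where m3: "\<forall>l\<ge>m3. \<forall>\<omega>\<in>?\<Sigma>.
      (\<forall>i<2 * l + 1. \<omega> (- int l + int i) = \<beta>1 (- int l + int i)) \<longrightarrow> \<omega> \<in> V1"
    using window[OF V(1,3)] by blast
  obtain m4 where m4: "\<forall>l\<ge>m4. \<forall>\<omega>\<in>?\<Sigma>.
      (\<forall>i<2 * l + 1. \<omega> (- int l + int i) = \<beta>2 (- int l + int i)) \<longrightarrow> \<omega> \<in> V2"
    using window[OF V(2,4)] by blast
  define l where "l = max (max m1 m2) (max m3 m4)"
  define L where "L = 2 * l + 1"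
  have ge: "m1 \<le> l" "m2 \<le> l" "m3 \<le> l" "m4 \<le> l" by (auto simp: l_def)
  have blocks: "\<exists>v. k \<le> level v \<and> (\<forall>w. fst v \<le> fst w \<longrightarrow> snd v \<le> snd w \<longrightarrow>
    (\<exists>p. p + L \<le> num_paths w \<and> (\<forall>i<L. \<omega> (- int l + int i) = block_letter \<xi> k w (p + i))))"
    if "openin ?X A" "\<omega> \<in> A" for A \<omega>
    by (rule window_in_larger_blocks[OF open_contains_window(1)[OF that]])
  obtain v1 where v1: "k \<le> level v1" "\<forall>w. fst v1 \<le> fst w \<longrightarrow> snd v1 \<le> snd w \<longrightarrow>
      (\<exists>p. p + L \<le> num_paths w \<and> (\<forall>i<L. \<alpha>1 (- int l + int i) = block_letter \<xi> k w (p + i)))"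
    using blocks[OF U(1,3)] by blast
  obtain v2 where v2: "k \<le> level v2" "\<forall>w. fst v2 \<le> fst w \<longrightarrow> snd v2 \<le> snd w \<longrightarrow>
      (\<exists>p. p + L \<le> num_paths w \<and> (\<forall>i<L. \<alpha>2 (- int l + int i) = block_letter \<xi> k w (p + i)))"
    using blocks[OF U(2,4)] by blast
  obtain v3 where v3: "k \<le> level v3" "\<forall>w. fst v3 \<le> fst w \<longrightarrow> snd v3 \<le> snd w \<longrightarrow>
      (\<exists>p. p + L \<le> num_paths w \<and> (\<forall>i<L. \<beta>1 (- int l + int i) = block_letter \<xi> k w (p + i)))"
    using blocks[OF V(1,3)] by blast
  obtain v4 where v4: "k \<le> level v4" "\<forall>w. fst v4 \<le> fst w \<longrightarrow> snd v4 \<le> snd w \<longrightarrow>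
      (\<exists>p. p + L \<le> num_paths w \<and> (\<forall>i<L. \<beta>2 (- int l + int i) = block_letter \<xi> k w (p + i)))"
    using blocks[OF V(2,4)] by blast
  define w where "w = (max (max (fst v1) (fst v2)) (max (fst v3) (fst v4)),
    max (max (snd v1) (snd v2)) (max (snd v3) (snd v4)))"
  have w_ge: "fst v1 \<le> fst w" "snd v1 \<le> snd w" "fst v2 \<le> fst w" "snd v2 \<le> snd w"
    "fst v3 \<le> fst w" "snd v3 \<le> snd w" "fst v4 \<le> fst w" "snd v4 \<le> snd w"
    by (simp_all add: w_def)
  have kw: "k \<le> level w" using v1(1) w_ge(1,2) by (simp add: level_def)
  obtain p1 where p1: "p1 + L \<le> num_paths w" "\<forall>i<L. \<alpha>1 (- int l + int i) = block_letter \<xi> k w (p1 + i)"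
    using v1(2) w_ge(1,2) by blast
  obtain p2 where p2: "p2 + L \<le> num_paths w" "\<forall>i<L. \<alpha>2 (- int l + int i) = block_letter \<xi> k w (p2 + i)"
    using v2(2) w_ge(3,4) by blast
  obtain q1 where q1: "q1 + L \<le> num_paths w" "\<forall>i<L. \<beta>1 (- int l + int i) = block_letter \<xi> k w (q1 + i)"
    using v3(2) w_ge(5,6) by blast
  obtain q2 where q2: "q2 + L \<le> num_paths w" "\<forall>i<L. \<beta>2 (- int l + int i) = block_letter \<xi> k w (q2 + i)"
    using v4(2) w_ge(7,8) by blast
  \<comment> \<open>The number of iterates has to be the same in both coordinates, which prescribes the
      difference of the two return times.\<close>
  obtain r1 r2 where r: "r1 \<in> returns \<xi> w" "r2 \<in> returns \<xi> w"
    "r1 - r2 = (int q2 - int p2) - (int q1 - int p1)" "int p1 - int q1 \<le> r1"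
    using returns_large_differences by metis
  define n where "n = nat (r1 + int q1 - int p1)"
  have n: "int n = r1 + int q1 - int p1" "int n = r2 + int q2 - int p2"
    using r(3,4) by (simp_all add: n_def)
  obtain \<omega>1 where \<omega>1: "\<omega>1 \<in> ?\<Sigma>" "\<forall>i<L. \<omega>1 (- int l + int i) = block_letter \<xi> k w (p1 + i) \<and>
      (shift ^^ n) \<omega>1 (- int l + int i) = block_letter \<xi> k w (q1 + i)"
    using subshift_joins_windows[OF kw r(1) p1(1) q1(1) n(1)] by blast
  obtain \<omega>2 where \<omega>2: "\<omega>2 \<in> ?\<Sigma>" "\<forall>i<L. \<omega>2 (- int l + int i) = block_letter \<xi> k w (p2 + i) \<and>
      (shift ^^ n) \<omega>2 (- int l + int i) = block_letter \<xi> k w (q2 + i)"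
    using subshift_joins_windows[OF kw r(2) p2(1) q2(1) n(2)] by blast
  have inv: "(shift ^^ n) \<omega> \<in> ?\<Sigma>" if "\<omega> \<in> ?\<Sigma>" for \<omega>
  proof -
    have "(shift ^^ n) \<omega> = (\<lambda>i. \<omega> (i + int n))" by (simp add: fun_eq_iff funpow_shift)
    then show ?thesis using adic_subshift_translate[OF that] by simp
  qed
  have "\<omega>1 \<in> U1" using m1 ge(1) \<omega>1 p1(2) by (simp add: L_def)
  moreover have "\<omega>2 \<in> U2" using m2 ge(2) \<omega>2 p2(2) by (simp add: L_def)
  moreover have "(shift ^^ n) \<omega>1 \<in> V1" using m3 ge(3) inv[OF \<omega>1(1)] \<omega>1(2) q1(2) by (simp add: L_def)
  moreover have "(shift ^^ n) \<omega>2 \<in> V2" using m4 ge(4) inv[OF \<omega>2(1)] \<omega>2(2) q2(2) by (simp add: L_def)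
  ultimately have "(\<omega>1, \<omega>2) \<in> U" "(map_prod shift shift ^^ n) (\<omega>1, \<omega>2) \<in> V"
    using U(5) V(5) by (auto simp: funpow_map_prod)
  then show "\<exists>n::nat. (map_prod shift shift ^^ n) ` U \<inter> V \<noteq> {}" by blast
qed

end
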